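(* Let $\gamma\in(0,1)$ and $0<y_0<t_0$. For $t>0$ and $y$ with $(t_0+t,y)\in C$ (i.e. $0<y<t_0+t$), the transition density of the space-time Brownian motion with drift killed at the boundary of $C$ is $$p^{k,C}_{(t_0,y_0)}(t,y)=\frac{1}{\sqrt{2\pi t}}e^{-\frac{(y-y_0-\gamma t)^2}{2t}}-\mathbb{E}_{(t_0,y_0)}\left(\frac{1}{\sqrt{2\pi(t-T)}}e^{-\frac{(y-Y_T-\gamma(t-T))^2}{2(t-T)}}\mathbf{1}_{T\le t}\right)$$ $$=\frac{1}{\sqrt{2\pi t}}\sum_{n\in\mathbb{Z}}\left(e^{-\frac{(y-2nt_0-y_0-\gamma t)^2}{2t}+\gamma(2nt_0+y_0)}-e^{-\frac{(y+2nt_0+y_0-\gamma t)^2}{2t}-\gamma(2nt_0+y_0)}\right)e^{-\gamma y_0-2n^2t_0-2ny_0}.$$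
   Context: Let $W$ be a standard one-dimensional Brownian motion, $B(t)=(t_0+t,\,Y_t)$ with $Y_t=y_0+W(t)+\gamma t$ the space-time Brownian motion with drift started at $(t_0,y_0)$, $C=\{(t',y):0<y<t'\}$ and $T=\inf\{t\ge0: B(t)\notin C\}$ the first exit time. The transition density of the killed process is defined by $p^{k,C}_{(t_0,y_0)}(t,y)\,dy=\mathbb{P}_{(t_0,y_0)}(Y_t\in dy,\ T>t)$. *)

theory Defs
  imports "HOL-Probability.Probability"
begin

text \<open>
  Standard one-dimensional Brownian motion on an arbitrary probability space. Only times
  \<open>t \<ge> 0\<close> are constrained. Paths are continuous for every outcome, not just almost every one, so
  that events about exit times are measurable without completing \<open>M\<close>.
\<close>

locale standard_brownian_motion = prob_space M
  for M :: "'a measure" and W :: "real \<Rightarrow> 'a \<Rightarrow> real" +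
  assumes measurable_W: "\<And>t. 0 \<le> t \<Longrightarrow> W t \<in> borel_measurable M"
    and start_zero: "AE \<omega> in M. W 0 \<omega> = 0"
    and continuous_paths: "\<And>\<omega>. \<omega> \<in> space M \<Longrightarrow> continuous_on {0..} (\<lambda>t. W t \<omega>)"
    and gaussian_increments: "\<And>s t. 0 \<le> s \<Longrightarrow> s < t \<Longrightarrow>
          distributed M lborel (\<lambda>\<omega>. W t \<omega> - W s \<omega>) (normal_density 0 (sqrt (t - s)))"
    and independent_increments: "\<And>(n::nat) (\<tau>::nat \<Rightarrow> real).
          0 \<le> \<tau> 0 \<Longrightarrow> (\<And>i. i < n \<Longrightarrow> \<tau> i < \<tau> (Suc i)) \<Longrightarrow>
          indep_vars (\<lambda>_. borel) (\<lambda>i \<omega>. W (\<tau> (Suc i)) \<omega> - W (\<tau> i) \<omega>) {..<n}"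

definition drifted :: "(real \<Rightarrow> 'a \<Rightarrow> real) \<Rightarrow> real \<Rightarrow> real \<Rightarrow> real \<Rightarrow> 'a \<Rightarrow> real" where
  "drifted W \<gamma> y0 t \<omega> = y0 + W t \<omega> + \<gamma> * t"

definition space_time ::
  "(real \<Rightarrow> 'a \<Rightarrow> real) \<Rightarrow> real \<Rightarrow> real \<Rightarrow> real \<Rightarrow> real \<Rightarrow> 'a \<Rightarrow> real \<times> real" where
  "space_time W \<gamma> t0 y0 t \<omega> = (t0 + t, drifted W \<gamma> y0 t \<omega>)"

definition space_time_cone :: "(real \<times> real) set" where
  "space_time_cone = {(t', y). 0 < y \<and> y < t'}"

text \<open>The value is \<open>\<infinity>\<close> on paths that never leave the cone (the infimum of the empty set).\<close>

definition exit_time ::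
  "(real \<Rightarrow> 'a \<Rightarrow> real) \<Rightarrow> real \<Rightarrow> real \<Rightarrow> real \<Rightarrow> 'a \<Rightarrow> ereal" where
  "exit_time W \<gamma> t0 y0 \<omega> = Inf (ereal ` {t. 0 \<le> t \<and> space_time W \<gamma> t0 y0 t \<omega> \<notin> space_time_cone})"

text \<open>
  \<open>p t y dy = P(Y\<^sub>t \<in> dy, T > t)\<close> for all \<open>t > 0\<close>. This determines each \<open>p t\<close> only up to a Lebesgue
  null set; on the section \<open>{0<..<t0 + t}\<close> of the cone, at most one choice is continuous.
\<close>

definition killed_transition_density ::
  "'a measure \<Rightarrow> (real \<Rightarrow> 'a \<Rightarrow> real) \<Rightarrow> real \<Rightarrow> real \<Rightarrow> real \<Rightarrow> (real \<Rightarrow> real \<Rightarrow> real) \<Rightarrow> bool" where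
  "killed_transition_density M W \<gamma> t0 y0 p \<longleftrightarrow>
     (\<forall>t>0. integrable lborel (p t) \<and>
       (\<forall>A\<in>sets borel.
          measure M {\<omega> \<in> space M. drifted W \<gamma> y0 t \<omega> \<in> A \<and> ereal t < exit_time W \<gamma> t0 y0 \<omega>}
          = (LINT y:A|lborel. p t y)))"

text \<open>
  \<open>p(t - T, Y\<^sub>T, y) 1{T \<le> t}\<close> for the free transition density \<open>p\<close> of the drifted motion. On the
  null event \<open>T = t\<close> division by zero makes this \<open>0\<close>.
\<close>

definition exit_kernel ::
  "(real \<Rightarrow> 'a \<Rightarrow> real) \<Rightarrow> real \<Rightarrow> real \<Rightarrow> real \<Rightarrow> real \<Rightarrow> real \<Rightarrow> 'a \<Rightarrow> real" where
  "exit_kernel W \<gamma> t0 y0 t y \<omega> =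
     (if exit_time W \<gamma> t0 y0 \<omega> \<le> ereal t
      then let T = real_of_ereal (exit_time W \<gamma> t0 y0 \<omega>) in
        1 / sqrt (2 * pi * (t - T)) *
        exp (- ((y - drifted W \<gamma> y0 T \<omega> - \<gamma> * (t - T))\<^sup>2) / (2 * (t - T)))
      else 0)"

definition image_term :: "real \<Rightarrow> real \<Rightarrow> real \<Rightarrow> real \<Rightarrow> real \<Rightarrow> int \<Rightarrow> real" where
  "image_term \<gamma> t0 y0 t y n =
     (exp (- ((y - 2 * of_int n * t0 - y0 - \<gamma> * t)\<^sup>2) / (2 * t) + \<gamma> * (2 * of_int n * t0 + y0))
      - exp (- ((y + 2 * of_int n * t0 + y0 - \<gamma> * t)\<^sup>2) / (2 * t) - \<gamma> * (2 * of_int n * t0 + y0)))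
     * exp (- \<gamma> * y0 - 2 * (of_int n)\<^sup>2 * t0 - 2 * of_int n * y0)"

end

theory Submission
  imports Defs
begin

text \<open>Write \<open>Y\<close> for the drifted motion, \<open>T\<close> for its exit time, \<open>L = t0 + t\<close> for the height of the cone at time
  \<open>t\<close>, and \<open>\<kappa>(z)\<close> for the random variable \<open>p(t - T, Y\<^sub>T, z) 1{T \<le> t}\<close>, where \<open>p\<close> is the free transition
  density. Let \<open>r(z)\<close> be the expectation of \<open>\<kappa>(z)\<close>, and \<open>f(z)\<close> the free density of \<open>Y\<^sub>t\<close>.

  First formula. The strong Markov property at \<open>T\<close> says that \<open>r\<close> is the density of \<open>Y\<^sub>t\<close> on the event
  \<open>T \<le> t\<close>, so \<open>f - r\<close> is the killed density. The strong Markov property is obtained by hand: the event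
  \<open>T > u\<close> is an iterated monotone limit of events that involve finitely many times of a dyadic grid, and for these
  independence of increments is directly applicable (\<open>markov_grid\<close>, \<open>markov_before_exit\<close>); then \<open>T\<close> is
  approximated from above by times on a grid (\<open>strong_markov_grid\<close>, \<open>strong_markov_exit\<close>). Away from
  the two points \<open>0\<close> and \<open>L\<close> the function \<open>r\<close> is continuous, because \<open>Y\<^sub>T\<close> lies on the boundary of
  the cone, so that \<open>\<kappa>(z)\<close> can only be large if \<open>z\<close> is close to \<open>0\<close> or \<open>L\<close>. Hence \<open>f - r\<close> is the only
  version of the killed density that is continuous on the section of the cone.

  Second formula. No path that is still in the cone at time \<open>t\<close> sits outside \<open>[0, L]\<close>, so there \<open>r = f\<close>,
  an explicit Gaussian (\<open>exit_density_outside\<close>). It remains to find \<open>r(y)\<close> for one \<open>y\<close> inside from the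
  values of \<open>r\<close> outside. Reflect \<open>y\<close> in both boundaries: sources at \<open>a\<^sub>n = y - 2nL\<close> and sinks at
  \<open>-a\<^sub>n\<close>, both with weight \<open>exp (2 n\<^sup>2 L - 2 n y)\<close>. The weighted sum of backward heat kernels with these
  poles vanishes on both boundary lines: on the line \<open>0\<close> the source \<open>n\<close> cancels the sink \<open>n\<close>, and on
  the moving line \<open>t0 + s\<close> it cancels the sink \<open>n + 1\<close> (\<open>reflect_pole\<close>). A drift multiplies the
  kernel by an exponential that splits into a factor depending on the pole and one depending on
  \<open>(T, Y\<^sub>T)\<close>, so it only changes the weights (\<open>normal_density_tilt\<close>). Evaluating at \<open>(T, Y\<^sub>T)\<close> and taking
  expectations, the sums of \<open>r\<close> over the sources and over the sinks agree
  (\<open>source_eq_sink_exit_density\<close>). Only \<open>a\<^sub>0 = y\<close> lies in \<open>[0, L]\<close>, so \<open>r(y)\<close> is the one unknown of this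
  equation, and solving it gives the series (\<open>killed_density_image_sum\<close>).\<close>

section \<open>Gaussian distribution functions and densities\<close>

abbreviation Phi :: "real \<Rightarrow> real" where
  "Phi \<equiv> cdf std_normal_distribution"

lemma Phi_nonneg: "0 \<le> Phi x" and Phi_le_1: "Phi x \<le> 1"
  using real_dist_normal_dist unfolding cdf_def real_distribution_def
  by (auto simp: prob_space.prob_le_1)

lemma isCont_Phi: "isCont Phi x"
proof -
  interpret real_distribution std_normal_distribution by (rule real_dist_normal_dist)
  have "emeasure std_normal_distribution {x} = 0"
    by (subst emeasure_density) (auto intro!: nn_integral_null_set simp: null_sets_def)
  then show ?thesis by (simp add: isCont_cdf measure_def)
qed

lemma continuous_on_Phi: "continuous_on UNIV Phi"
  by (simp add: continuous_on_eq_continuous_at isCont_Phi)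

lemma measurable_Phi [measurable]: "Phi \<in> borel_measurable borel"
  by (rule borel_measurable_continuous_onI[OF continuous_on_Phi])

lemma emeasure_normal_atMost:
  assumes "0 < \<sigma>"
  shows "(\<integral>\<^sup>+y. ennreal (normal_density \<mu> \<sigma> y) * indicator {..b} y \<partial>lborel) = ennreal (Phi ((b - \<mu>) / \<sigma>))"
proof -
  interpret real_distribution std_normal_distribution by (rule real_dist_normal_dist)
  have dens: "\<sigma> * normal_density \<mu> \<sigma> (\<mu> + \<sigma> * x) = std_normal_density x" for x
    using assms by (simp add: normal_density_def real_sqrt_mult power_mult_distrib)
  have "(\<integral>\<^sup>+y. ennreal (normal_density \<mu> \<sigma> y) * indicator {..b} y \<partial>lborel)
      = ennreal \<bar>\<sigma>\<bar> * (\<integral>\<^sup>+x. ennreal (normal_density \<mu> \<sigma> (\<mu> + \<sigma> * x)) * indicator {..b} (\<mu> + \<sigma> * x) \<partial>lborel)"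
    using assms by (intro nn_integral_real_affine) auto
  also have "\<dots> = (\<integral>\<^sup>+x. ennreal (std_normal_density x) * indicator {..(b - \<mu>) / \<sigma>} x \<partial>lborel)"
  proof (subst nn_integral_cmult[symmetric])
    have "\<mu> + \<sigma> * x \<le> b \<longleftrightarrow> x \<le> (b - \<mu>) / \<sigma>" for x
      using assms by (simp add: field_simps)
    then have ind: "indicator {..b} (\<mu> + \<sigma> * x) = (indicator {..(b - \<mu>) / \<sigma>} x :: ennreal)" for x
      by (simp add: indicator_def)
    show "(\<integral>\<^sup>+x. ennreal \<bar>\<sigma>\<bar> * (ennreal (normal_density \<mu> \<sigma> (\<mu> + \<sigma> * x)) * indicator {..b} (\<mu> + \<sigma> * x)) \<partial>lborel)
        = (\<integral>\<^sup>+x. ennreal (std_normal_density x) * indicator {..(b - \<mu>) / \<sigma>} x \<partial>lborel)"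
      using assms by (simp add: ind dens[symmetric] ennreal_mult mult.assoc)
  qed measurable
  also have "\<dots> = emeasure std_normal_distribution {..(b - \<mu>) / \<sigma>}"
    by (subst emeasure_density) auto
  finally show ?thesis
    by (simp add: cdf_def emeasure_eq_measure)
qed

text \<open>Integrating out a Gaussian variable that is independent of \<open>X\<close> replaces the indicator of
  \<open>{V \<le> h X}\<close> by its conditional probability. The Gaussian is given as a function of \<open>Z\<close> because
  independence of two variables is only defined for a common range type, which forces a single increment
  to be viewed as a family indexed by a singleton.\<close>
lemma (in prob_space) integral_freeze_gaussian:
  assumes indep: "indep_var S X S' Z" and f [measurable]: "f \<in> borel_measurable S'"
    and V: "distributed M lborel (\<lambda>\<omega>. f (Z \<omega>)) (normal_density 0 \<sigma>)" and \<sigma>: "0 < \<sigma>"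
    and Q: "Q \<in> sets S" and h [measurable]: "h \<in> borel_measurable S"
  shows "(\<integral>\<omega>. indicator Q (X \<omega>) * (indicator {..h (X \<omega>)} (f (Z \<omega>)) - Phi (h (X \<omega>) / \<sigma>)) \<partial>M) = (0::real)"
proof -
  note [measurable] = Q indep_var_rv1[OF indep] indep_var_rv2[OF indep]
  interpret Z: prob_space "distr M S' Z" by (rule prob_space_distr) simp
  let ?E = "{p \<in> space (S \<Otimes>\<^sub>M S'). fst p \<in> Q \<and> f (snd p) \<le> h (fst p)}"
  have E: "?E \<in> sets (S \<Otimes>\<^sub>M S')" by measurable
  have Z_cdf: "emeasure (distr M S' Z) {z \<in> space S'. f z \<le> c} = ennreal (Phi (c / \<sigma>))" for c
  proof -
    have "emeasure (distr M S' Z) {z \<in> space S'. f z \<le> c} = emeasure M ((\<lambda>\<omega>. f (Z \<omega>)) -` {..c} \<inter> space M)"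
      using measurable_space[OF indep_var_rv2[OF indep]]
      by (subst emeasure_distr) (auto intro!: arg_cong[where f="emeasure M"])
    also have "\<dots> = (\<integral>\<^sup>+y. ennreal (normal_density 0 \<sigma> y) * indicator {..c} y \<partial>lborel)"
      by (rule distributed_emeasure[OF V]) simp
    finally show ?thesis by (simp add: emeasure_normal_atMost[OF \<sigma>])
  qed
  have "emeasure M {\<omega>\<in>space M. X \<omega> \<in> Q \<and> f (Z \<omega>) \<le> h (X \<omega>)} = emeasure (distr M (S \<Otimes>\<^sub>M S') (\<lambda>\<omega>. (X \<omega>, Z \<omega>))) ?E"
    using measurable_space[OF indep_var_rv1[OF indep]] measurable_space[OF indep_var_rv2[OF indep]]
    by (subst emeasure_distr[OF _ E]) (auto intro!: arg_cong[where f="emeasure M"] simp: space_pair_measure)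
  also have "distr M (S \<Otimes>\<^sub>M S') (\<lambda>\<omega>. (X \<omega>, Z \<omega>)) = distr M S X \<Otimes>\<^sub>M distr M S' Z"
    using indep by (simp add: indep_var_distribution_eq)
  also have "emeasure \<dots> ?E = (\<integral>\<^sup>+x. emeasure (distr M S' Z) (Pair x -` ?E) \<partial>distr M S X)"
  proof (rule Z.emeasure_pair_measure_alt)
    have "sets (distr M S X \<Otimes>\<^sub>M distr M S' Z) = sets (S \<Otimes>\<^sub>M S')"
      by (rule sets_pair_measure_cong) simp_all
    then show "?E \<in> sets (distr M S X \<Otimes>\<^sub>M distr M S' Z)" using E by (simp only:)
  qed
  also have "\<dots> = (\<integral>\<^sup>+x. ennreal (indicator Q x * Phi (h x / \<sigma>)) \<partial>distr M S X)"
  proof (rule nn_integral_cong)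
    fix x assume x: "x \<in> space (distr M S X)"
    have "Pair x -` ?E = (if x \<in> Q then {z \<in> space S'. f z \<le> h x} else {})"
      using x by (auto simp: space_pair_measure)
    then show "emeasure (distr M S' Z) (Pair x -` ?E) = ennreal (indicator Q x * Phi (h x / \<sigma>))"
      by (auto simp: Z_cdf)
  qed
  also have "\<dots> = (\<integral>\<^sup>+\<omega>. ennreal (indicator Q (X \<omega>) * Phi (h (X \<omega>) / \<sigma>)) \<partial>M)"
    by (rule nn_integral_distr) measurable
  also have "\<dots> = ennreal (\<integral>\<omega>. indicator Q (X \<omega>) * Phi (h (X \<omega>) / \<sigma>) \<partial>M)"
    by (intro nn_integral_eq_integral integrable_const_bound[where B=1])
       (auto simp: Phi_nonneg Phi_le_1 split: split_indicator)
  finally have "emeasure M {\<omega>\<in>space M. X \<omega> \<in> Q \<and> f (Z \<omega>) \<le> h (X \<omega>)} = ennreal (\<integral>\<omega>. indicator Q (X \<omega>) * Phi (h (X \<omega>) / \<sigma>) \<partial>M)" .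
  moreover have pos: "0 \<le> (\<integral>\<omega>. indicator Q (X \<omega>) * Phi (h (X \<omega>) / \<sigma>) \<partial>M)"
    by (intro Bochner_Integration.integral_nonneg mult_nonneg_nonneg Phi_nonneg) simp
  ultimately have *: "measure M {\<omega>\<in>space M. X \<omega> \<in> Q \<and> f (Z \<omega>) \<le> h (X \<omega>)} = (\<integral>\<omega>. indicator Q (X \<omega>) * Phi (h (X \<omega>) / \<sigma>) \<partial>M)"
    using pos by (simp only: measure_def enn2real_ennreal)
  have "(\<integral>\<omega>. indicat_real Q (X \<omega>) * indicator {..h (X \<omega>)} (f (Z \<omega>)) \<partial>M)
      = (\<integral>\<omega>. indicator {\<omega>\<in>space M. X \<omega> \<in> Q \<and> f (Z \<omega>) \<le> h (X \<omega>)} \<omega> \<partial>M)"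
    by (intro Bochner_Integration.integral_cong) (auto split: split_indicator)
  also have "\<dots> = measure M {\<omega>\<in>space M. X \<omega> \<in> Q \<and> f (Z \<omega>) \<le> h (X \<omega>)}"
    by simp
  finally have "(\<integral>\<omega>. indicat_real Q (X \<omega>) * indicator {..h (X \<omega>)} (f (Z \<omega>)) \<partial>M)
      = (\<integral>\<omega>. indicator Q (X \<omega>) * Phi (h (X \<omega>) / \<sigma>) \<partial>M)"
    unfolding * .
  moreover have "integrable M (\<lambda>\<omega>. indicator Q (X \<omega>) * indicator {..h (X \<omega>)} (f (Z \<omega>)) :: real)"
    unfolding indicator_def atMost_iff by (intro integrable_const_bound[where B=1]) auto
  moreover have "integrable M (\<lambda>\<omega>. indicator Q (X \<omega>) * Phi (h (X \<omega>) / \<sigma>) :: real)"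
    by (intro integrable_const_bound[where B=1]) (auto simp: Phi_nonneg Phi_le_1 split: split_indicator)
  ultimately show ?thesis
    by (simp only: right_diff_distrib Bochner_Integration.integral_diff diff_self)
qed

text \<open>A bound that stays finite when the variance vanishes, as long as \<open>y\<close> keeps away from the mean. It
  comes from \<open>1 + a \<le> exp a\<close> with \<open>a\<close> the squared distance in units of the variance. For
  \<open>\<sigma> = 0\<close> the density is \<open>0\<close> by division by zero.\<close>
lemma normal_density_le:
  assumes "0 \<le> \<sigma>" "0 < c" "c \<le> \<sigma>\<^sup>2 + (y - m)\<^sup>2"
  shows "normal_density m \<sigma> y \<le> 1 / sqrt (2 * pi * c)"
proof (cases "\<sigma> = 0")
  case True
  then show ?thesis using assms by (simp add: normal_density_def)
next
  case False
  with assms have \<sigma>: "0 < \<sigma>" by simp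
  define a where "a = (y - m)\<^sup>2 / \<sigma>\<^sup>2"
  have a: "0 \<le> a" unfolding a_def by simp
  have "\<sigma>\<^sup>2 * a = (y - m)\<^sup>2"
    using \<sigma> by (simp add: a_def)
  then have "c \<le> \<sigma>\<^sup>2 * (1 + a)"
    using assms(3) by (simp only: distrib_left mult_1_right)
  also have "\<dots> \<le> \<sigma>\<^sup>2 * exp a"
    using exp_ge_add_one_self[of a] by (intro mult_left_mono) auto
  finally have "2 * pi * c \<le> 2 * pi * (\<sigma>\<^sup>2 * exp a)"
    by (intro mult_left_mono) auto
  also have "\<dots> = (sqrt (2 * pi * \<sigma>\<^sup>2) * exp (a / 2))\<^sup>2"
  proof -
    have "(exp (a / 2))\<^sup>2 = exp a"
      using exp_double[of "a / 2"] by simp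
    then show ?thesis by (simp add: power_mult_distrib)
  qed
  finally have *: "2 * pi * c \<le> (sqrt (2 * pi * \<sigma>\<^sup>2) * exp (a / 2))\<^sup>2" .
  have "sqrt (2 * pi * c) \<le> sqrt (2 * pi * \<sigma>\<^sup>2) * exp (a / 2)"
    by (rule real_le_lsqrt[OF _ *]) simp
  then have "1 / (sqrt (2 * pi * \<sigma>\<^sup>2) * exp (a / 2)) \<le> 1 / sqrt (2 * pi * c)"
  proof (rule divide_left_mono)
    have "0 < sqrt (2 * pi * c)" using assms(2) by simp
    moreover have "0 < sqrt (2 * pi * \<sigma>\<^sup>2) * exp (a / 2)" using \<sigma> by simp
    ultimately show "0 < sqrt (2 * pi * \<sigma>\<^sup>2) * exp (a / 2) * sqrt (2 * pi * c)"
      by (simp only: mult_pos_pos)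
  qed simp
  moreover have "normal_density m \<sigma> y = 1 / (sqrt (2 * pi * \<sigma>\<^sup>2) * exp (a / 2))"
  proof -
    have "- (y - m)\<^sup>2 / (2 * \<sigma>\<^sup>2) = - (a / 2)"
      by (simp add: a_def)
    then show ?thesis
      unfolding normal_density_def by (simp only: exp_minus divide_inverse inverse_mult_distrib mult_1_left)
  qed
  ultimately show ?thesis by simp
qed

lemma continuous_on_normal_density: "continuous_on S (normal_density m \<sigma>)"
  unfolding normal_density_def[abs_def] divide_inverse by (intro continuous_intros)

text \<open>The drift as an exponential change of weight: on the right, the exponential no longer depends on the
  endpoint \<open>z\<close>, so that sums over several endpoints reduce to the case without drift.\<close>
lemma normal_density_tilt:
  assumes "0 < \<tau>"
  shows "exp (\<gamma> * (y - z)) * normal_density (x + \<gamma> * \<tau>) (sqrt \<tau>) z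
    = exp (\<gamma> * (y - x) - \<gamma>\<^sup>2 * \<tau> / 2) * normal_density x (sqrt \<tau>) z"
proof -
  have "\<gamma> * (y - z) + - (z - (x + \<gamma> * \<tau>))\<^sup>2 / (2 * \<tau>)
      = \<gamma> * (y - x) - \<gamma>\<^sup>2 * \<tau> / 2 + - (z - x)\<^sup>2 / (2 * \<tau>)"
    using assms by (simp add: field_simps power2_eq_square)
  then have "exp (\<gamma> * (y - z)) * exp (- (z - (x + \<gamma> * \<tau>))\<^sup>2 / (2 * \<tau>))
      = exp (\<gamma> * (y - x) - \<gamma>\<^sup>2 * \<tau> / 2) * exp (- (z - x)\<^sup>2 / (2 * \<tau>))"
    by (simp only: exp_add[symmetric])
  then show ?thesis
    using assms by (simp add: normal_density_def)
qed

section \<open>Uniqueness of continuous densities and sums over the integers\<close>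

text \<open>Equal integrals force equality almost everywhere, and the set where two continuous functions differ is
  open, hence empty if it is negligible.\<close>
lemma continuous_density_unique:
  fixes f g :: "real \<Rightarrow> real"
  assumes int: "integrable lborel f" "integrable lborel g" and U: "open U"
    and cont: "continuous_on U f" "continuous_on U g"
    and eq: "\<And>A. A \<in> sets borel \<Longrightarrow> A \<subseteq> U \<Longrightarrow> (LINT y:A|lborel. f y) = (LINT y:A|lborel. g y)"
    and x: "x \<in> U"
  shows "f x = g x"
proof -
  have AE: "AE y in lborel. indicator U y *\<^sub>R f y = indicator U y *\<^sub>R g y"
  proof (rule density_unique_real)
    show "integrable lborel (\<lambda>y. indicator U y *\<^sub>R f y)" "integrable lborel (\<lambda>y. indicator U y *\<^sub>R g y)"
      using U by (auto intro!: integrable_mult_indicator[OF _ int(1)] integrable_mult_indicator[OF _ int(2)]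
          simp del: real_scaleR_def)
    fix A :: "real set" assume "A \<in> sets lborel"
    then have "(LINT y:A \<inter> U|lborel. f y) = (LINT y:A \<inter> U|lborel. g y)"
      using U by (intro eq) auto
    then show "(LINT y:A|lborel. indicator U y *\<^sub>R f y) = (LINT y:A|lborel. indicator U y *\<^sub>R g y)"
      by (simp add: set_lebesgue_integral_def indicator_inter_arith mult.assoc)
  qed
  define N where "N = {y\<in>U. f y \<noteq> g y}"
  have "N = U \<inter> (\<lambda>y. f y - g y) -` (- {0})" by (auto simp: N_def)
  also have "open \<dots>"
    using cont U by (intro continuous_open_preimage continuous_intros) auto
  finally have "open N" .
  moreover have "N \<in> null_sets lborel"
    using AE \<open>open N\<close> by (subst AE_iff_null_sets) (auto elim!: eventually_mono simp: N_def)
  then have "negligible N"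
    by (simp add: negligible_iff_null_sets null_sets_completionI)
  ultimately have "N = {}" using open_not_negligible by blast
  then show ?thesis using x by (auto simp: N_def)
qed

lemma nn_integral_count_space_has_sum:
  fixes f :: "'a \<Rightarrow> real"
  assumes "(f has_sum S) UNIV" "\<And>i. 0 \<le> f i"
  shows "(\<integral>\<^sup>+i. ennreal (f i) \<partial>count_space UNIV) = ennreal S"
proof -
  have "integrable (count_space UNIV) f"
    using assms(1) summable_on_iff_abs_summable_on_real[of f UNIV] abs_summable_equivalent[of f UNIV]
    by (auto simp: abs_summable_on_def has_sum_iff)
  moreover from this have "integral\<^sup>L (count_space UNIV) f = S"
    using infsetsum_infsum[of f UNIV] assms(1)
    by (simp add: infsetsum_def abs_summable_on_def has_sum_iff)
  ultimately show ?thesis using assms(2) by (simp add: nn_integral_eq_integral)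
qed

lemma summable_on_power_abs_int:
  fixes r :: real
  assumes "0 \<le> r" "r < 1"
  shows "(\<lambda>n::int. r ^ nat \<bar>n\<bar>) summable_on UNIV"
proof -
  have "summable (\<lambda>n. r ^ n)" using assms by (intro summable_geometric) simp
  then have nat: "(\<lambda>n::nat. r ^ n) summable_on UNIV"
    using assms by (subst summable_on_UNIV_nonneg_real_iff) auto
  have "(\<lambda>n::int. r ^ nat \<bar>n\<bar>) summable_on range int"
    by (subst summable_on_reindex) (auto simp: comp_def nat inj_on_def)
  moreover have "(\<lambda>n::int. r ^ nat \<bar>n\<bar>) summable_on range (\<lambda>n. - int n)"
    by (subst summable_on_reindex) (auto simp: comp_def nat inj_on_def)
  ultimately have "(\<lambda>n::int. r ^ nat \<bar>n\<bar>) summable_on (range int \<union> range (\<lambda>n. - int n))"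
    by (rule summable_on_union)
  also have "range int \<union> range (\<lambda>n. - int n) = UNIV"
    by (auto intro: int_cases2)
  finally show ?thesis .
qed

text \<open>Completing the square gives a geometric majorant \<open>exp (K - \<bar>n\<bar>)\<close>.\<close>
lemma summable_on_gaussian_int:
  fixes A B C :: real
  assumes "0 < A"
  shows "(\<lambda>n::int. exp (- (A * (of_int n)\<^sup>2) + B * of_int n + C)) summable_on UNIV"
proof -
  define K where "K = (\<bar>B\<bar> + 1)\<^sup>2 / (4 * A) + C"
  have "(\<lambda>n::int. exp K * exp (-1) ^ nat \<bar>n\<bar>) summable_on UNIV"
    by (intro summable_on_cmult_right summable_on_power_abs_int) auto
  then show ?thesis
  proof (rule summable_on_comparison_test)
    fix n :: int
    define x :: real where "x = \<bar>of_int n\<bar>"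
    have "B * of_int n \<le> \<bar>B\<bar> * x"
      unfolding x_def by (metis abs_ge_self abs_mult)
    moreover have "- (A * x\<^sup>2) + (\<bar>B\<bar> + 1) * x \<le> (\<bar>B\<bar> + 1)\<^sup>2 / (4 * A)"
    proof -
      have "0 \<le> (2 * A * x - (\<bar>B\<bar> + 1))\<^sup>2" by simp
      then have "4 * A * (- (A * x\<^sup>2) + (\<bar>B\<bar> + 1) * x) \<le> (\<bar>B\<bar> + 1)\<^sup>2"
        by (simp add: power2_eq_square algebra_simps)
      then show ?thesis using assms by (simp add: pos_le_divide_eq mult.commute)
    qed
    moreover have "x\<^sup>2 = (of_int n)\<^sup>2" by (simp add: x_def)
    ultimately have "- (A * (of_int n)\<^sup>2) + B * of_int n + C \<le> K + real (nat \<bar>n\<bar>) * (-1)"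
      by (simp add: K_def x_def distrib_right)
    then have "exp (- (A * (of_int n)\<^sup>2) + B * of_int n + C) \<le> exp (K + real (nat \<bar>n\<bar>) * (-1))"
      by simp
    also have "\<dots> = exp K * exp (-1) ^ nat \<bar>n\<bar>"
      by (simp only: exp_add exp_of_nat_mult)
    finally show "exp (- (A * (of_int n)\<^sup>2) + B * of_int n + C) \<le> exp K * exp (-1) ^ nat \<bar>n\<bar>" .
  qed simp
qed

section \<open>The exit time from the cone\<close>

locale cone_exit = standard_brownian_motion M W
  for M :: "'a measure" and W :: "real \<Rightarrow> 'a \<Rightarrow> real" +
  fixes \<gamma> t0 y0 :: real
  assumes y0_pos: "0 < y0" and y0_less: "y0 < t0"
begin

abbreviation "Y \<equiv> drifted W \<gamma> y0"
abbreviation "T \<equiv> exit_time W \<gamma> t0 y0"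

lemma measurable_Y [measurable (raw)]: "0 \<le> t \<Longrightarrow> Y t \<in> borel_measurable M"
  using measurable_W[of t] unfolding drifted_def by measurable

lemma continuous_on_Y: "\<omega> \<in> space M \<Longrightarrow> continuous_on {0..} (\<lambda>t. Y t \<omega>)"
  unfolding drifted_def by (intro continuous_intros continuous_paths)

lemma in_cone_iff:
  "space_time W \<gamma> t0 y0 t \<omega> \<in> space_time_cone \<longleftrightarrow> 0 < Y t \<omega> \<and> Y t \<omega> < t0 + t"
  by (simp add: space_time_def space_time_cone_def)

text \<open>By continuity of the path the set of times outside the cone is closed, so its infimum is attained.\<close>
lemma exit_time_cases:
  assumes "\<omega> \<in> space M"
  obtains (infinite) "T \<omega> = \<infinity>" "\<And>v. 0 \<le> v \<Longrightarrow> 0 < Y v \<omega> \<and> Y v \<omega> < t0 + v"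
  | (finite) s where "0 \<le> s" "T \<omega> = ereal s" "\<not> (0 < Y s \<omega> \<and> Y s \<omega> < t0 + s)"
      "\<And>v. 0 \<le> v \<Longrightarrow> v < s \<Longrightarrow> 0 < Y v \<omega> \<and> Y v \<omega> < t0 + v"
proof -
  define S where "S = {t. 0 \<le> t \<and> \<not> (0 < Y t \<omega> \<and> Y t \<omega> < t0 + t)}"
  have T: "T \<omega> = Inf (ereal ` S)"
    by (simp add: exit_time_def in_cone_iff S_def)
  show thesis
  proof (cases "S = {}")
    case True
    then have "T \<omega> = \<infinity>" by (simp add: T top_ereal_def)
    moreover have "0 < Y v \<omega> \<and> Y v \<omega> < t0 + v" if "0 \<le> v" for v
      using True that by (auto simp: S_def)
    ultimately show thesis by (rule infinite)
  next
    case False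
    have "S = {0..} \<inter> (\<lambda>t. min (Y t \<omega>) (t0 + t - Y t \<omega>)) -` {..0}"
      by (auto simp: S_def min_le_iff_disj)
    moreover have "closed \<dots>"
      by (intro continuous_closed_preimage continuous_intros continuous_on_Y assms closed_atMost closed_atLeast)
    ultimately have "closed S" by simp
    have bdd: "bdd_below S" by (rule bdd_belowI[of _ 0]) (simp add: S_def)
    have mem: "Inf S \<in> S" by (rule closed_contains_Inf) (use False bdd \<open>closed S\<close> in auto)
    have least: "Inf S \<le> v" if "v \<in> S" for v by (rule cInf_lower[OF that bdd])
    have "T \<omega> = ereal (Inf S)"
      unfolding T using mem least by (intro antisym Inf_greatest Inf_lower) auto
    then show thesis
      using mem least by (intro finite[of "Inf S"]) (fastforce simp: S_def)+
  qed
qed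

lemma exit_time_gt_iff:
  assumes "\<omega> \<in> space M" "0 \<le> u"
  shows "ereal u < T \<omega> \<longleftrightarrow> (\<forall>v\<in>{0..u}. 0 < Y v \<omega> \<and> Y v \<omega> < t0 + v)"
  using assms(1)
proof (cases rule: exit_time_cases)
  case (finite s)
  then show ?thesis using assms(2) by (auto simp: not_le)
qed auto

lemma exit_time_nonneg: "\<omega> \<in> space M \<Longrightarrow> 0 \<le> T \<omega>"
  by (erule exit_time_cases) auto

lemma AE_start: "AE \<omega> in M. Y 0 \<omega> = y0"
  using start_zero by eventually_elim (simp add: drifted_def)

text \<open>The path starts in the open cone and is inside it before the exit time, so its left limit there lies in
  the closed cone.\<close>
lemma exit_on_boundary:
  assumes "\<omega> \<in> space M" "Y 0 \<omega> = y0" "T \<omega> = ereal s"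
  shows "0 < s" "Y s \<omega> = 0 \<or> Y s \<omega> = t0 + s"
proof -
  from assms(1) have *: "0 \<le> s \<and> \<not> (0 < Y s \<omega> \<and> Y s \<omega> < t0 + s) \<and>
      (\<forall>v. 0 \<le> v \<longrightarrow> v < s \<longrightarrow> 0 < Y v \<omega> \<and> Y v \<omega> < t0 + v)"
    by (cases rule: exit_time_cases) (use assms(3) in auto)
  then show "0 < s" using assms(2) y0_pos y0_less by (cases "s = 0") auto
  have "isCont (\<lambda>v. Y v \<omega>) s"
    using continuous_on_subset[OF continuous_on_Y[OF assms(1)], of "{0<..}"] \<open>0 < s\<close>
    by (simp add: continuous_on_eq_continuous_at subset_eq)
  then have cont: "((\<lambda>v. Y v \<omega>) \<longlongrightarrow> Y s \<omega>) (at_left s)"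
    by (simp add: isCont_def filterlim_at_split)
  have ev: "eventually (\<lambda>v. 0 < Y v \<omega> \<and> Y v \<omega> < t0 + v) (at_left s)"
    using eventually_at_left_real[OF \<open>0 < s\<close>] * by (auto elim!: eventually_mono)
  have "0 \<le> Y s \<omega>"
    by (rule tendsto_lowerbound[OF cont]) (use ev in \<open>auto elim!: eventually_mono\<close>)
  moreover have "Y s \<omega> \<le> t0 + s"
    by (rule tendsto_le[OF _ _ cont, of "\<lambda>v. t0 + v"])
      (use ev in \<open>auto elim!: eventually_mono intro!: tendsto_intros\<close>)
  ultimately show "Y s \<omega> = 0 \<or> Y s \<omega> = t0 + s" using * by auto
qed

text \<open>Closed conditions with a margin \<open>e\<close>, so that they pass to limits of times. A path stays in the open
  cone on a compact time interval iff it satisfies them there for some margin.\<close>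
definition deep_in_cone :: "real \<Rightarrow> real \<Rightarrow> 'a \<Rightarrow> bool" where
  "deep_in_cone e v \<omega> \<longleftrightarrow> e \<le> Y v \<omega> \<and> Y v \<omega> \<le> t0 + v - e"

text \<open>The condition is tested at the points \<open>s * i / 2^m\<close> up to time \<open>u\<close>. The grid subdivides \<open>[0, s]\<close>
  rather than \<open>[0, u]\<close> because the Markov property is needed at \<open>s\<close> on the event that the path has not
  left the cone by the possibly earlier time \<open>u\<close>.\<close>
definition grid_in_cone :: "real \<Rightarrow> real \<Rightarrow> nat \<Rightarrow> nat \<Rightarrow> 'a set" where
  "grid_in_cone s u j m = {\<omega> \<in> space M. \<forall>i\<le>2^m. s * real i / 2^m \<le> u \<longrightarrow>
     deep_in_cone (1 / real (Suc j)) (s * real i / 2^m) \<omega>}"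

lemma grid_in_cone_mono_j: "j \<le> j' \<Longrightarrow> grid_in_cone s u j m \<subseteq> grid_in_cone s u j' m"
proof -
  assume "j \<le> j'"
  then have "1 / real (Suc j') \<le> 1 / real (Suc j)" by (simp add: frac_le)
  then have "deep_in_cone (1 / real (Suc j)) v \<omega> \<Longrightarrow> deep_in_cone (1 / real (Suc j')) v \<omega>" for v \<omega>
    unfolding deep_in_cone_def by linarith
  then show ?thesis unfolding grid_in_cone_def by blast
qed

lemma grid_in_cone_Suc: "grid_in_cone s u j (Suc m) \<subseteq> grid_in_cone s u j m"
proof
  fix \<omega> assume *: "\<omega> \<in> grid_in_cone s u j (Suc m)"
  have "deep_in_cone (1 / real (Suc j)) (s * real i / 2^m) \<omega>"
    if i: "i \<le> 2^m" "s * real i / 2^m \<le> u" for i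
  proof -
    have eq: "s * real (2*i) / 2^(Suc m) = s * real i / 2^m" by simp
    have "2*i \<le> 2^Suc m" using i by simp
    then have "s * real (2*i) / 2^(Suc m) \<le> u \<longrightarrow>
        deep_in_cone (1 / real (Suc j)) (s * real (2*i) / 2^(Suc m)) \<omega>"
      using * unfolding grid_in_cone_def by blast
    then show ?thesis using i(2) unfolding eq by simp
  qed
  then show "\<omega> \<in> grid_in_cone s u j m"
    using * by (simp add: grid_in_cone_def)
qed

lemma sets_grid_in_cone: 
  assumes "0 \<le> s" shows "grid_in_cone s u j m \<in> sets M"
proof -
  have [measurable]: "Y (s * real i / 2^m) \<in> borel_measurable M" for i
    using assms by (intro measurable_Y) auto
  show ?thesis unfolding grid_in_cone_def deep_in_cone_def by measurable
qed

text \<open>From left to right: the distance to the boundary of the cone has a positive minimum on \<open>[0, u]\<close>. From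
  right to left: every time is the limit of grid times from below.\<close>
lemma exit_time_gt_grid:
  assumes \<omega>: "\<omega> \<in> space M" and u: "0 \<le> u" "u \<le> s" "0 < s"
  shows "ereal u < T \<omega> \<longleftrightarrow> (\<exists>j. \<forall>m. \<omega> \<in> grid_in_cone s u j m)"
proof
  let ?f = "\<lambda>v. min (Y v \<omega>) (t0 + v - Y v \<omega>)"
  have cont: "continuous_on {0..} ?f"
    by (intro continuous_intros continuous_on_Y \<omega>)
  assume "ereal u < T \<omega>"
  then have pos: "0 < ?f v" if "v \<in> {0..u}" for v
    using that by (auto simp: exit_time_gt_iff[OF \<omega> u(1)])
  obtain v0 where v0: "v0 \<in> {0..u}" "\<And>v. v \<in> {0..u} \<Longrightarrow> ?f v0 \<le> ?f v"
    using continuous_attains_inf[of "{0..u}" ?f] u(1) continuous_on_subset[OF cont, of "{0..u}"]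
    by auto
  obtain j where j: "1 / real (Suc j) < ?f v0"
    using pos[OF v0(1)] nat_approx_posE by blast
  have "\<omega> \<in> grid_in_cone s u j m" for m
  proof -
    have "deep_in_cone (1 / real (Suc j)) (s * real i / 2^m) \<omega>" if "s * real i / 2^m \<le> u" for i
    proof -
      have "?f v0 \<le> ?f (s * real i / 2^m)" using u that by (intro v0(2)) auto
      then show ?thesis unfolding deep_in_cone_def using j by linarith
    qed
    then show ?thesis using \<omega> by (simp add: grid_in_cone_def)
  qed
  then show "\<exists>j. \<forall>m. \<omega> \<in> grid_in_cone s u j m" by blast
next
  assume "\<exists>j. \<forall>m. \<omega> \<in> grid_in_cone s u j m"
  then obtain j where j: "\<And>m. \<omega> \<in> grid_in_cone s u j m" by blast
  let ?e = "1 / real (Suc j)"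
  have "?e \<le> Y v \<omega> \<and> Y v \<omega> \<le> t0 + v - ?e" if v: "v \<in> {0..u}" for v
  proof -
    \<comment> \<open>The last grid point before \<open>v\<close>.\<close>
    define i where "i m = nat \<lfloor>2^m * v / s\<rfloor>" for m :: nat
    let ?v = "\<lambda>m. s * real (i m) / 2^m"
    have i: "real (i m) \<le> 2^m * v / s" "2^m * v / s - 1 < real (i m)" for m
      unfolding i_def using v u by (auto simp: of_nat_nat)
    have vm: "?v m \<le> v" for m
      using i(1)[of m] u by (simp add: field_simps)
    have vm': "v - s * (1/2)^m \<le> ?v m" for m
      using mult_left_mono[OF less_imp_le[OF i(2)[of m]], of "s / 2^m"] u
      by (simp add: right_diff_distrib power_divide)
    have im: "i m \<le> 2^m" for m
    proof -
      have "real (i m) \<le> 2^m * v / s" by (rule i)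
      also have "\<dots> \<le> 2^m * 1" using v u by (auto simp: field_simps)
      finally show ?thesis by (metis mult_1_right of_nat_le_iff of_nat_numeral of_nat_power)
    qed
    have lim: "?v \<longlonglongrightarrow> v"
    proof (rule tendsto_sandwich[OF _ _ _ tendsto_const])
      show "(\<lambda>m. v - s * (1/2)^m) \<longlonglongrightarrow> v"
        by (auto intro!: tendsto_eq_intros LIMSEQ_power_zero)
    qed (use vm vm' in auto)
    have "(\<lambda>m. Y (?v m) \<omega>) \<longlonglongrightarrow> Y v \<omega>"
      by (rule continuous_on_tendsto_compose[OF continuous_on_Y[OF \<omega>] lim]) (use v u in auto)
    moreover have "?e \<le> Y (?v m) \<omega> \<and> Y (?v m) \<omega> \<le> t0 + ?v m - ?e" for m
      using j[of m] im[of m] vm[of m] v unfolding grid_in_cone_def deep_in_cone_def by force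
    ultimately show ?thesis
      by (intro conjI LIMSEQ_le_const[of "\<lambda>m. Y (?v m) \<omega>"] LIMSEQ_le[of "\<lambda>m. Y (?v m) \<omega>" _ "\<lambda>m. t0 + ?v m - ?e"]
          tendsto_intros lim) blast+
  qed
  moreover have "0 < ?e" by simp
  ultimately show "ereal u < T \<omega>"
    unfolding exit_time_gt_iff[OF \<omega> u(1)] by (smt (verit, ccfv_threshold))
qed

lemma sets_exit_time_gt: "0 \<le> u \<Longrightarrow> {\<omega> \<in> space M. ereal u < T \<omega>} \<in> sets M"
proof -
  assume u: "0 \<le> u"
  have "{\<omega> \<in> space M. ereal u < T \<omega>} = (\<Union>j. \<Inter>m. grid_in_cone (u+1) u j m)"
    using exit_time_gt_grid[OF _ u, of _ "u+1"] u by (auto simp: grid_in_cone_def)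
  also have "\<dots> \<in> sets M"
    using u by (intro sets.countable_UN) (auto intro!: sets_grid_in_cone sets.countable_INT)
  finally show ?thesis .
qed

lemma measurable_exit_time [measurable]: "T \<in> borel_measurable M"
proof (rule borel_measurableI_greater)
  fix y :: ereal
  show "{x \<in> space M. y < T x} \<in> sets M"
  proof (cases "y < 0")
    case True
    then have "{x \<in> space M. y < T x} = space M" using exit_time_nonneg by (auto intro: less_le_trans)
    then show ?thesis by simp
  next
    case False
    then show ?thesis by (cases y) (auto intro: sets_exit_time_gt)
  qed
qed

section \<open>The Markov property before exit\<close>

lemma grid_increments_indep:
  assumes "0 < s" "s < t" "0 < N"
  shows "indep_var (PiM {..<N} (\<lambda>_. borel))
           (\<lambda>\<omega>. \<lambda>i\<in>{..<N}. W (s * real (Suc i) / real N) \<omega> - W (s * real i / real N) \<omega>)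
           (PiM {N} (\<lambda>_. borel)) (\<lambda>\<omega>. \<lambda>i\<in>{N}. W t \<omega> - W s \<omega>)"
proof -
  define \<tau> where "\<tau> i = (if i \<le> N then s * real i / real N else t)" for i
  let ?\<Delta> = "\<lambda>i \<omega>. W (\<tau> (Suc i)) \<omega> - W (\<tau> i) \<omega>"
  have "indep_vars (\<lambda>_. borel) ?\<Delta> {..<Suc N}"
  proof (rule independent_increments)
    show "0 \<le> \<tau> 0" by (simp add: \<tau>_def)
    fix i assume "i < Suc N"
    then consider "i < N" | "i = N" by linarith
    then show "\<tau> i < \<tau> (Suc i)"
      using assms by cases (auto simp: \<tau>_def divide_strict_right_mono)
  qed
  then have "indep_var (PiM {..<N} (\<lambda>_. borel)) (\<lambda>\<omega>. restrict (\<lambda>i. ?\<Delta> i \<omega>) {..<N})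
      (PiM {N} (\<lambda>_. borel)) (\<lambda>\<omega>. restrict (\<lambda>i. ?\<Delta> i \<omega>) {N})"
    by (rule indep_var_restrict) auto
  moreover have "(\<lambda>\<omega>. restrict (\<lambda>i. ?\<Delta> i \<omega>) {..<N})
      = (\<lambda>\<omega>. \<lambda>i\<in>{..<N}. W (s * real (Suc i) / real N) \<omega> - W (s * real i / real N) \<omega>)"
    by (auto simp: \<tau>_def fun_eq_iff restrict_def)
  moreover have "(\<lambda>\<omega>. restrict (\<lambda>i. ?\<Delta> i \<omega>) {N}) = (\<lambda>\<omega>. \<lambda>i\<in>{N}. W t \<omega> - W s \<omega>)"
    using assms by (auto simp: \<tau>_def fun_eq_iff restrict_def)
  ultimately show ?thesis by simp
qed

text \<open>The probability that the drifted motion started at \<open>x\<close> is at most \<open>b\<close> after time \<open>\<tau>\<close>. The value at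
  \<open>\<tau> = 0\<close> is that of the motion that has not moved, so that the last grid time needs no special
  treatment.\<close>
definition transition_cdf :: "real \<Rightarrow> real \<Rightarrow> real \<Rightarrow> real" where
  "transition_cdf b \<tau> x = (if \<tau> = 0 then indicator {..b} x else Phi ((b - x - \<gamma> * \<tau>) / sqrt \<tau>))"

lemma transition_cdf_nonneg: "0 \<le> transition_cdf b \<tau> x" and transition_cdf_le_1: "transition_cdf b \<tau> x \<le> 1"
  by (auto simp: transition_cdf_def Phi_nonneg Phi_le_1)

lemma measurable_transition_cdf [measurable]:
  "(\<lambda>p. transition_cdf b (fst p) (snd p)) \<in> borel_measurable borel"
  unfolding transition_cdf_def borel_prod[symmetric] by measurable

lemma abs_indicator_diff_transition_cdf_le_1: "\<bar>indicator {..b} y - transition_cdf b \<tau> x\<bar> \<le> 1"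
  using transition_cdf_nonneg[of b \<tau> x] transition_cdf_le_1[of b \<tau> x] by (auto split: split_indicator)

text \<open>The event and \<open>Y s\<close> are functions of the increments over the grid cells, which are independent of
  \<open>W t - W s\<close>. This uses that almost surely \<open>W 0 = 0\<close>.\<close>
lemma markov_grid:
  assumes st: "0 < s" "s < t"
  shows "(\<integral>\<omega>. indicator (grid_in_cone s u j m) \<omega> * (indicator {..b} (Y t \<omega>) - transition_cdf b (t - s) (Y s \<omega>)) \<partial>M) = 0"
proof -
  define N :: nat where "N = 2^m"
  have N: "0 < N" by (simp add: N_def)
  define e where "e = 1 / real (Suc j)"
  define X where "X \<omega> = (\<lambda>i\<in>{..<N}. W (s * real (Suc i) / real N) \<omega> - W (s * real i / real N) \<omega>)" for \<omega>
  let ?S = "PiM {..<N} (\<lambda>_. borel :: real measure)"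
  define pos where "pos g i = y0 + (\<Sum>l<i. g l) + \<gamma> * (s * real i / real N)" for g :: "nat \<Rightarrow> real" and i
  have [measurable]: "(\<lambda>g. pos g i) \<in> borel_measurable ?S" if "i \<le> N" for i
    unfolding pos_def
    by (intro borel_measurable_add borel_measurable_const borel_measurable_sum measurable_component_singleton)
       (use that in auto)
  define Q where "Q = {g \<in> space ?S. \<forall>i\<in>{..N}. s * real i / real N \<le> u \<longrightarrow>
      e \<le> pos g i \<and> pos g i \<le> t0 + s * real i / real N - e}"
  have Q: "Q \<in> sets ?S" unfolding Q_def by measurable
  define h where "h g = b - pos g N - \<gamma> * (t - s)" for g
  have h: "h \<in> borel_measurable ?S" unfolding h_def by measurable
  have "(\<integral>\<omega>. indicator Q (X \<omega>) * (indicator {..h (X \<omega>)} (W t \<omega> - W s \<omega>) - Phi (h (X \<omega>) / sqrt (t - s))) \<partial>M) = (0::real)"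
    using integral_freeze_gaussian[OF grid_increments_indep[OF st N], of "\<lambda>f. f N" "sqrt (t - s)" Q h]
      gaussian_increments[of s t] st Q h
    by (simp add: X_def)
  also have "(\<integral>\<omega>. indicator Q (X \<omega>) * (indicator {..h (X \<omega>)} (W t \<omega> - W s \<omega>) - Phi (h (X \<omega>) / sqrt (t - s))) \<partial>M)
    = (\<integral>\<omega>. indicator (grid_in_cone s u j m) \<omega> * (indicator {..b} (Y t \<omega>) - transition_cdf b (t - s) (Y s \<omega>)) \<partial>M)"
  proof (rule integral_cong_AE)
    have [measurable]: "X \<in> measurable M ?S"
      using indep_var_rv1[OF grid_increments_indep[OF st N]] unfolding X_def .
    have [measurable]: "W t \<in> borel_measurable M" "W s \<in> borel_measurable M"
      using st by (auto intro: measurable_W)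
    have [measurable]: "Y t \<in> borel_measurable M" "Y s \<in> borel_measurable M"
      using st by (auto intro: measurable_Y)
    have [measurable]: "(\<lambda>\<omega>. h (X \<omega>)) \<in> borel_measurable M"
      by (rule measurable_compose[OF _ h]) measurable
    have [measurable]: "(\<lambda>\<omega>. indicator Q (X \<omega>) :: real) \<in> borel_measurable M"
      by (rule measurable_compose[OF _ borel_measurable_indicator[OF Q]]) measurable
    note [measurable] = sets_grid_in_cone[OF less_imp_le[OF st(1)]]
    show "(\<lambda>\<omega>. indicator Q (X \<omega>) * (indicator {..h (X \<omega>)} (W t \<omega> - W s \<omega>) - Phi (h (X \<omega>) / sqrt (t - s)))) \<in> borel_measurable M"
      unfolding indicator_def[of "{.._}"] atMost_iff by measurable
    show "(\<lambda>\<omega>. indicator (grid_in_cone s u j m) \<omega> * (indicator {..b} (Y t \<omega>) - transition_cdf b (t - s) (Y s \<omega>))) \<in> borel_measurable M"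
      using measurable_compose[OF _ measurable_transition_cdf, of "\<lambda>\<omega>. (t - s, Y s \<omega>)" M b] by simp measurable
    show "AE \<omega> in M. indicator Q (X \<omega>) * (indicator {..h (X \<omega>)} (W t \<omega> - W s \<omega>) - Phi (h (X \<omega>) / sqrt (t - s)))
       = indicator (grid_in_cone s u j m) \<omega> * (indicator {..b} (Y t \<omega>) - transition_cdf b (t - s) (Y s \<omega>))"
      using start_zero AE_space
    proof eventually_elim
      fix \<omega> assume W0: "W 0 \<omega> = 0" and \<omega>: "\<omega> \<in> space M"
      have pos: "pos (X \<omega>) i = Y (s * real i / real N) \<omega>" if "i \<le> N" for i
      proof -
        have "(\<Sum>l<i. X \<omega> l) = (\<Sum>l<i. W (s * real (Suc l) / real N) \<omega> - W (s * real l / real N) \<omega>)"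
          using that by (intro sum.cong) (auto simp: X_def)
        also have "\<dots> = W (s * real i / real N) \<omega>"
          by (subst sum_lessThan_telescope) (simp add: W0)
        finally show ?thesis by (simp add: pos_def drifted_def)
      qed
      have "X \<omega> \<in> space ?S" by (auto simp: X_def space_PiM PiE_def extensional_def)
      then have "X \<omega> \<in> Q \<longleftrightarrow> \<omega> \<in> grid_in_cone s u j m"
        using \<omega> pos by (auto simp: Q_def grid_in_cone_def deep_in_cone_def e_def N_def)
      moreover have "pos (X \<omega>) N = Y s \<omega>" using pos[of N] N by simp
      then have hX: "h (X \<omega>) = b - Y s \<omega> - \<gamma> * (t - s)" by (simp add: h_def)
      moreover have "W t \<omega> - W s \<omega> \<le> h (X \<omega>) \<longleftrightarrow> Y t \<omega> \<le> b"
        by (auto simp: hX drifted_def algebra_simps)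
      ultimately show "indicator Q (X \<omega>) * (indicator {..h (X \<omega>)} (W t \<omega> - W s \<omega>) - Phi (h (X \<omega>) / sqrt (t - s)))
       = indicator (grid_in_cone s u j m) \<omega> * (indicator {..b} (Y t \<omega>) - transition_cdf b (t - s) (Y s \<omega>))"
        using st by (simp add: transition_cdf_def indicator_def)
    qed
  qed
  finally show ?thesis .
qed

text \<open>Dominated convergence, first along refining grids (decreasing events), then along shrinking margins
  (increasing events).\<close>
lemma markov_before_exit:
  assumes u: "0 \<le> u" "u \<le> s" and st: "0 < s" "s < t"
  shows "(\<integral>\<omega>. indicator {\<omega>. ereal u < T \<omega>} \<omega> * (indicator {..b} (Y t \<omega>) - transition_cdf b (t - s) (Y s \<omega>)) \<partial>M) = 0"
proof -
  define D where "D \<omega> = indicator {..b} (Y t \<omega>) - transition_cdf b (t - s) (Y s \<omega>)" for \<omega>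
  have [measurable]: "Y t \<in> borel_measurable M" "Y s \<in> borel_measurable M"
    using st by (auto intro: measurable_Y)
  have [measurable]: "D \<in> borel_measurable M"
    using measurable_compose[OF _ measurable_transition_cdf, of "\<lambda>\<omega>. (t - s, Y s \<omega>)" M b]
    unfolding D_def by simp measurable
  have D_le: "\<bar>D \<omega>\<bar> \<le> 1" for \<omega>
    unfolding D_def by (rule abs_indicator_diff_transition_cdf_le_1)
  have bound: "norm (indicator A \<omega> * D \<omega>) \<le> 1" for A \<omega>
    using D_le[of \<omega>] by (auto split: split_indicator)
  note [measurable] = sets_grid_in_cone[OF less_imp_le[OF st(1)]]
  have grid: "(\<integral>\<omega>. indicator (grid_in_cone s u j m) \<omega> * D \<omega> \<partial>M) = 0" for j m
    unfolding D_def by (rule markov_grid[OF st])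
  have decseq: "decseq (grid_in_cone s u j)" for j
    by (rule decseq_SucI) (rule grid_in_cone_Suc)
  have incseq: "incseq (\<lambda>j. \<Inter>m. grid_in_cone s u j m)"
    using grid_in_cone_mono_j by (fastforce simp: incseq_def)
  have inter: "(\<integral>\<omega>. indicator (\<Inter>m. grid_in_cone s u j m) \<omega> * D \<omega> \<partial>M) = 0" for j
  proof -
    have "(\<lambda>m. \<integral>\<omega>. indicator (grid_in_cone s u j m) \<omega> * D \<omega> \<partial>M)
        \<longlonglongrightarrow> (\<integral>\<omega>. indicator (\<Inter>m. grid_in_cone s u j m) \<omega> * D \<omega> \<partial>M)"
      by (rule integral_dominated_convergence[where w="\<lambda>_. 1"])
         (auto intro!: tendsto_mult LIMSEQ_indicator_decseq decseq bound simp del: real_norm_def)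
    then show ?thesis by (simp add: grid LIMSEQ_const_iff)
  qed
  have "(\<lambda>j. \<integral>\<omega>. indicator (\<Inter>m. grid_in_cone s u j m) \<omega> * D \<omega> \<partial>M)
        \<longlonglongrightarrow> (\<integral>\<omega>. indicator (\<Union>j. \<Inter>m. grid_in_cone s u j m) \<omega> * D \<omega> \<partial>M)"
    by (rule integral_dominated_convergence[where w="\<lambda>_. 1"])
       (auto intro!: tendsto_mult LIMSEQ_indicator_incseq incseq bound simp del: real_norm_def)
  then have "(\<integral>\<omega>. indicator (\<Union>j. \<Inter>m. grid_in_cone s u j m) \<omega> * D \<omega> \<partial>M) = 0"
    by (simp add: inter LIMSEQ_const_iff)
  also have "(\<integral>\<omega>. indicator (\<Union>j. \<Inter>m. grid_in_cone s u j m) \<omega> * D \<omega> \<partial>M)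
      = (\<integral>\<omega>. indicator {\<omega>. ereal u < T \<omega>} \<omega> * D \<omega> \<partial>M)"
    by (intro Bochner_Integration.integral_cong) (auto simp: exit_time_gt_grid[OF _ u st(1)] indicator_def)
  finally show ?thesis unfolding D_def .
qed

section \<open>The strong Markov property at the exit time\<close>

text \<open>A real number also on paths that never leave the cone, so that the path can be evaluated at it.\<close>
definition exit_min :: "real \<Rightarrow> 'a \<Rightarrow> real" where
  "exit_min t \<omega> = real_of_ereal (min (T \<omega>) (ereal t))"

text \<open>The stopped time is rounded up, so that whether a path has left the cone by then is known at the
  rounded time.\<close>
definition stop_index :: "real \<Rightarrow> nat \<Rightarrow> 'a \<Rightarrow> nat" where
  "stop_index t n \<omega> = nat \<lceil>exit_min t \<omega> * real (Suc n) / t\<rceil>"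

abbreviation grid_stop :: "real \<Rightarrow> nat \<Rightarrow> 'a \<Rightarrow> real" where
  "grid_stop t n \<omega> \<equiv> t * real (stop_index t n \<omega>) / real (Suc n)"

lemma measurable_exit_min [measurable]: "exit_min t \<in> borel_measurable M"
  unfolding exit_min_def by measurable

lemma exit_min_bounds:
  assumes "\<omega> \<in> space M" "0 \<le> t"
  shows "0 \<le> exit_min t \<omega>" "exit_min t \<omega> \<le> t" "T \<omega> \<le> ereal t \<Longrightarrow> ereal (exit_min t \<omega>) = T \<omega>"
    "ereal t < T \<omega> \<Longrightarrow> exit_min t \<omega> = t"
  using exit_time_nonneg[OF assms(1)] assms(2)
  by (cases "T \<omega>"; auto simp: exit_min_def min_def)+

lemma grid_stop_bounds:
  assumes "\<omega> \<in> space M" "0 < t"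
  shows "exit_min t \<omega> \<le> grid_stop t n \<omega>" "grid_stop t n \<omega> < exit_min t \<omega> + t / real (Suc n)"
    "stop_index t n \<omega> \<le> Suc n"
proof -
  let ?x = "exit_min t \<omega> * real (Suc n) / t"
  have x: "0 \<le> ?x" using exit_min_bounds(1)[OF assms(1), of t] assms(2) by simp
  have c: "?x \<le> real (stop_index t n \<omega>)" "real (stop_index t n \<omega>) < ?x + 1"
    unfolding stop_index_def using x by (auto simp: of_nat_nat) linarith+
  show "exit_min t \<omega> \<le> grid_stop t n \<omega>"
    using mult_left_mono[OF c(1), of "t / real (Suc n)"] assms(2) by simp
  show "grid_stop t n \<omega> < exit_min t \<omega> + t / real (Suc n)"
    using mult_strict_left_mono[OF c(2), of "t / real (Suc n)"] assms(2) by (simp add: distrib_left del: of_nat_Suc)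
  have "?x \<le> real (Suc n)"
    using exit_min_bounds(2)[OF assms(1), of t] assms(2) by (simp add: divide_le_eq mult.commute)
  then show "stop_index t n \<omega> \<le> Suc n"
    unfolding stop_index_def by linarith
qed

lemma grid_stop_tendsto:
  assumes "\<omega> \<in> space M" "0 < t"
  shows "(\<lambda>n. grid_stop t n \<omega>) \<longlonglongrightarrow> exit_min t \<omega>"
proof (rule tendsto_sandwich[OF _ _ tendsto_const])
  show "(\<lambda>n. exit_min t \<omega> + t / real (Suc n)) \<longlonglongrightarrow> exit_min t \<omega>"
    using tendsto_add[OF tendsto_const LIMSEQ_Suc[OF lim_const_over_n[of t]], of "exit_min t \<omega>"] by simp
qed (use grid_stop_bounds[OF assms] in \<open>auto intro!: always_eventually less_imp_le\<close>)

lemma measurable_stop_index [measurable]: "stop_index t n \<in> measurable M (count_space UNIV)"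
  unfolding stop_index_def by measurable

text \<open>The rounded time has countably many values, which makes the stopped path measurable, and with it the
  path stopped at its exact exit time.\<close>
lemma measurable_Y_grid_stop [measurable]:
  assumes "0 < t"
  shows "(\<lambda>\<omega>. Y (grid_stop t n \<omega>) \<omega>) \<in> borel_measurable M"
  by (rule measurable_compose_countable[where f = "\<lambda>k \<omega>. Y (t * real k / real (Suc n)) \<omega>"])
     (use assms in \<open>auto intro!: measurable_Y\<close>)

lemma Y_grid_stop_tendsto:
  assumes "\<omega> \<in> space M" "0 < t"
  shows "(\<lambda>n. Y (grid_stop t n \<omega>) \<omega>) \<longlonglongrightarrow> Y (exit_min t \<omega>) \<omega>"
  by (rule continuous_on_tendsto_compose[OF continuous_on_Y[OF assms(1)] grid_stop_tendsto[OF assms]])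
     (use assms exit_min_bounds(1)[OF assms(1), of t] in auto)

lemma measurable_Y_stop [measurable]:
  assumes "0 < t"
  shows "(\<lambda>\<omega>. Y (exit_min t \<omega>) \<omega>) \<in> borel_measurable M"
  by (rule borel_measurable_LIMSEQ_real[OF Y_grid_stop_tendsto measurable_Y_grid_stop]) (use assms in auto)

lemma measurable_transition_cdf_compose [measurable (raw)]:
  "f \<in> borel_measurable N \<Longrightarrow> g \<in> borel_measurable N \<Longrightarrow> (\<lambda>x. transition_cdf b (f x) (g x)) \<in> borel_measurable N"
  using measurable_compose[OF borel_measurable_Pair measurable_transition_cdf, of f N g b] by simp

text \<open>On \<open>0 < T \<le> t\<close> exactly one grid cell \<open>(s k, s (k + 1)]\<close> contains \<open>T\<close>. Its indicator is a difference of
  indicators of \<open>T > s k\<close> and \<open>T > s (k + 1)\<close>, to both of which the Markov property at time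
  \<open>s (k + 1)\<close> applies.\<close>
lemma strong_markov_grid:
  assumes t: "0 < t"
  shows "(\<integral>\<omega>. indicator {\<omega>. 0 < T \<omega> \<and> T \<omega> \<le> ereal t} \<omega> *
     (indicator {..b} (Y t \<omega>) - transition_cdf b (t - grid_stop t n \<omega>) (Y (grid_stop t n \<omega>) \<omega>)) \<partial>M) = 0"
proof -
  define s where "s k = t * real k / real (Suc n)" for k
  define D where "D k \<omega> = indicator {..b} (Y t \<omega>) - transition_cdf b (t - s k) (Y (s k) \<omega>)" for k \<omega>
  have [measurable]: "Y t \<in> borel_measurable M" "Y (s k) \<in> borel_measurable M" for k
    using t by (auto intro: measurable_Y simp: s_def)
  have [measurable]: "D k \<in> borel_measurable M" for k
    unfolding D_def by measurable
  have D_le: "\<bar>D k \<omega>\<bar> \<le> 1" for k \<omega>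
    unfolding D_def by (rule abs_indicator_diff_transition_cdf_le_1)
  have s_pos: "0 \<le> s k" for k using t by (simp add: s_def)
  have s_mono: "k \<le> l \<Longrightarrow> s k \<le> s l" for k l
    using t by (simp add: s_def divide_right_mono)
  have s_Suc_n: "s (Suc n) = t" by (simp add: s_def)
  have int: "integrable M (\<lambda>\<omega>. indicator {\<omega>. ereal u < T \<omega>} \<omega> * D k \<omega>)" for u k
    by (intro integrable_const_bound[where B=1]) (use D_le in \<open>auto split: split_indicator\<close>)
  have zero: "(\<integral>\<omega>. indicator {\<omega>. ereal (s l) < T \<omega>} \<omega> * D (Suc k) \<omega> \<partial>M) = 0"
    if "l \<le> Suc k" "k \<le> n" for k l
  proof (cases "k = n")
    case True
    have "D (Suc k) \<omega> = 0" for \<omega> unfolding D_def True s_Suc_n by (simp add: transition_cdf_def)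
    then show ?thesis by simp
  next
    case False
    have "s (Suc k) < t" using that False t by (simp add: s_def divide_less_eq)
    then show ?thesis unfolding D_def
      by (intro markov_before_exit s_pos s_mono that) (use t in \<open>auto simp: s_def\<close>)
  qed
  have split: "indicator {\<omega>. 0 < T \<omega> \<and> T \<omega> \<le> ereal t} \<omega> * D (stop_index t n \<omega>) \<omega>
      = (\<Sum>k\<le>n. (indicator {\<omega>. ereal (s k) < T \<omega>} \<omega> - indicator {\<omega>. ereal (s (Suc k)) < T \<omega>} \<omega>) * D (Suc k) \<omega>)"
    if \<omega>: "\<omega> \<in> space M" for \<omega>
  proof (cases "0 < T \<omega> \<and> T \<omega> \<le> ereal t")
    case True
    let ?N = "stop_index t n \<omega>"
    have T: "T \<omega> = ereal (exit_min t \<omega>)"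
      using True exit_min_bounds(3)[OF \<omega>, of t] t by simp
    have pos: "0 < exit_min t \<omega>"
      using True unfolding T by simp
    have sN: "exit_min t \<omega> \<le> s ?N" "s ?N < exit_min t \<omega> + t / real (Suc n)"
      unfolding s_def by (rule grid_stop_bounds[OF \<omega> t])+
    have step: "s (Suc k) = s k + t / real (Suc n)" for k
      by (simp add: s_def distrib_left add_divide_distrib)
    have "s 0 = 0" by (simp add: s_def)
    then have "?N \<noteq> 0" using sN(1) pos by (metis not_le)
    then obtain k where k: "?N = Suc k" by (cases ?N) auto
    have "k \<le> n" using grid_stop_bounds(3)[OF \<omega> t, of n] k by simp
    have sk: "s k < exit_min t \<omega>" "exit_min t \<omega> \<le> s (Suc k)" using sN step[of k] k by auto
    have "(\<Sum>l\<le>n. (indicator {\<omega>. ereal (s l) < T \<omega>} \<omega> - indicator {\<omega>. ereal (s (Suc l)) < T \<omega>} \<omega>) * D (Suc l) \<omega>)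
       = (\<Sum>l\<in>{k}. (indicator {\<omega>. ereal (s l) < T \<omega>} \<omega> - indicator {\<omega>. ereal (s (Suc l)) < T \<omega>} \<omega>) * D (Suc l) \<omega>)"
    proof (rule sum.mono_neutral_right)
      show "\<forall>l\<in>{..n} - {k}. (indicator {\<omega>. ereal (s l) < T \<omega>} \<omega> - indicator {\<omega>. ereal (s (Suc l)) < T \<omega>} \<omega>) * D (Suc l) \<omega> = 0"
      proof
        fix l assume "l \<in> {..n} - {k}"
        then consider "l < k" | "k < l" by force
        then show "(indicator {\<omega>. ereal (s l) < T \<omega>} \<omega> - indicator {\<omega>. ereal (s (Suc l)) < T \<omega>} \<omega>) * D (Suc l) \<omega> = 0"
        proof cases
          case 1
          then have "s l < exit_min t \<omega>" "s (Suc l) < exit_min t \<omega>"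
            using sk s_mono[of l k] s_mono[of "Suc l" k] by auto
          then show ?thesis by (simp add: T)
        next
          case 2
          then have "\<not> s l < exit_min t \<omega>" "\<not> s (Suc l) < exit_min t \<omega>"
            using sk s_mono[of "Suc k" l] s_mono[of "Suc k" "Suc l"] by auto
          then show ?thesis by (simp add: T)
        qed
      qed
    qed (use \<open>k \<le> n\<close> in auto)
    then show ?thesis using sk True by (simp add: T k)
  next
    case False
    then have "T \<omega> = 0 \<or> ereal t < T \<omega>" using exit_time_nonneg[OF \<omega>] by (auto simp: not_less)
    then show ?thesis
    proof
      assume "T \<omega> = 0"
      then show ?thesis using s_pos by (auto simp: zero_ereal_def not_less)
    next
      assume *: "ereal t < T \<omega>"
      have "s k \<le> t" if "k \<le> Suc n" for k using s_mono[OF that] by (simp add: s_Suc_n)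
      then have "ereal (s k) < T \<omega>" if "k \<le> Suc n" for k
        using that * by (meson ereal_less_eq(3) le_less_trans)
      then show ?thesis using False by (auto intro!: sum.neutral[symmetric])
    qed
  qed
  have "(\<integral>\<omega>. indicator {\<omega>. 0 < T \<omega> \<and> T \<omega> \<le> ereal t} \<omega> * D (stop_index t n \<omega>) \<omega> \<partial>M)
    = (\<integral>\<omega>. (\<Sum>k\<le>n. indicator {\<omega>. ereal (s k) < T \<omega>} \<omega> * D (Suc k) \<omega> - indicator {\<omega>. ereal (s (Suc k)) < T \<omega>} \<omega> * D (Suc k) \<omega>) \<partial>M)"
    by (intro Bochner_Integration.integral_cong) (simp_all add: split left_diff_distrib)
  also have "\<dots> = 0"
    by (simp add: Bochner_Integration.integral_sum Bochner_Integration.integral_diff int zero)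
  finally show ?thesis by (simp add: D_def s_def)
qed

lemma AE_Y_neq:
  assumes t: "0 < t"
  shows "AE \<omega> in M. Y t \<omega> \<noteq> c"
proof -
  have [measurable]: "W t \<in> borel_measurable M" "W 0 \<in> borel_measurable M"
    using t by (auto intro: measurable_W)
  have D: "distributed M lborel (\<lambda>\<omega>. W t \<omega> - W 0 \<omega>) (normal_density 0 (sqrt (t - 0)))"
    using gaussian_increments[of 0 t] t by simp
  have "emeasure M ((\<lambda>\<omega>. W t \<omega> - W 0 \<omega>) -` {c - y0 - \<gamma> * t} \<inter> space M) = 0"
    by (subst distributed_emeasure[OF D]) (auto intro!: nn_integral_null_set simp: null_sets_def)
  moreover have "(\<lambda>\<omega>. W t \<omega> - W 0 \<omega>) -` {c - y0 - \<gamma> * t} \<inter> space M = {\<omega> \<in> space M. W t \<omega> - W 0 \<omega> = c - y0 - \<gamma> * t}"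
    by auto
  ultimately have "AE \<omega> in M. W t \<omega> - W 0 \<omega> \<noteq> c - y0 - \<gamma> * t"
    by (subst AE_iff_measurable[OF _ refl]) auto
  then show ?thesis
    using start_zero by eventually_elim (auto simp: drifted_def)
qed

text \<open>The exit time differs from any fixed positive time, since at exit the path is on the boundary, which the
  continuous distribution of \<open>Y t\<close> does not charge.\<close>
lemma AE_exit_time: "AE \<omega> in M. 0 < T \<omega>" "0 < t \<Longrightarrow> AE \<omega> in M. T \<omega> \<noteq> ereal t"
proof -
  show "AE \<omega> in M. 0 < T \<omega>"
    using AE_start AE_space
  proof eventually_elim
    fix \<omega> assume *: "Y 0 \<omega> = y0" "\<omega> \<in> space M"
    show "0 < T \<omega>"
      using exit_time_nonneg[OF *(2)] exit_on_boundary(1)[OF *(2,1)] by (cases "T \<omega>") auto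
  qed
  assume t: "0 < t"
  show "AE \<omega> in M. T \<omega> \<noteq> ereal t"
    using AE_start AE_space AE_Y_neq[OF t, of 0] AE_Y_neq[OF t, of "t0 + t"]
    by eventually_elim (use exit_on_boundary(2) in blast)
qed

lemma tendsto_transition_cdf:
  assumes "x \<longlonglongrightarrow> x'" "\<tau> \<longlonglongrightarrow> \<tau>'" "0 < \<tau>'"
  shows "(\<lambda>n. transition_cdf b (\<tau> n) (x n)) \<longlonglongrightarrow> transition_cdf b \<tau>' x'"
proof -
  have "(\<lambda>n. Phi ((b - x n - \<gamma> * \<tau> n) / sqrt (\<tau> n))) \<longlonglongrightarrow> Phi ((b - x' - \<gamma> * \<tau>') / sqrt \<tau>')"
    by (rule isCont_tendsto_compose[OF isCont_Phi]) (use assms in \<open>auto intro!: tendsto_intros\<close>)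
  moreover have "eventually (\<lambda>n. 0 < \<tau> n) sequentially"
    using assms(2,3) by (rule order_tendstoD)
  then have "eventually (\<lambda>n. Phi ((b - x n - \<gamma> * \<tau> n) / sqrt (\<tau> n)) = transition_cdf b (\<tau> n) (x n)) sequentially"
    by eventually_elim (simp add: transition_cdf_def)
  ultimately show ?thesis
    using assms(3) by (auto simp: transition_cdf_def elim: Lim_transform_eventually)
qed

text \<open>The limit of the rounded times. The distribution function of the remaining motion is continuous as long
  as the remaining time is positive, which is why \<open>T \<noteq> t\<close> almost surely is needed.\<close>
lemma strong_markov_exit:
  assumes t: "0 < t"
  shows "(\<integral>\<omega>. indicator {\<omega>. T \<omega> \<le> ereal t} \<omega> *
     (indicator {..b} (Y t \<omega>) - transition_cdf b (t - exit_min t \<omega>) (Y (exit_min t \<omega>) \<omega>)) \<partial>M) = 0"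
proof -
  have [measurable]: "Y t \<in> borel_measurable M" using t by (auto intro: measurable_Y)
  note [measurable] = measurable_Y_grid_stop[OF t] measurable_Y_stop[OF t]
  have "(\<lambda>n. \<integral>\<omega>. indicator {\<omega>. 0 < T \<omega> \<and> T \<omega> \<le> ereal t} \<omega> *
     (indicator {..b} (Y t \<omega>) - transition_cdf b (t - grid_stop t n \<omega>) (Y (grid_stop t n \<omega>) \<omega>)) \<partial>M)
   \<longlonglongrightarrow> (\<integral>\<omega>. indicator {\<omega>. T \<omega> \<le> ereal t} \<omega> *
     (indicator {..b} (Y t \<omega>) - transition_cdf b (t - exit_min t \<omega>) (Y (exit_min t \<omega>) \<omega>)) \<partial>M)"
  proof (rule integral_dominated_convergence[where w="\<lambda>_. 1"])
    show "AE \<omega> in M. (\<lambda>n. indicator {\<omega>. 0 < T \<omega> \<and> T \<omega> \<le> ereal t} \<omega> *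
       (indicator {..b} (Y t \<omega>) - transition_cdf b (t - grid_stop t n \<omega>) (Y (grid_stop t n \<omega>) \<omega>)))
      \<longlonglongrightarrow> indicator {\<omega>. T \<omega> \<le> ereal t} \<omega> *
     (indicator {..b} (Y t \<omega>) - transition_cdf b (t - exit_min t \<omega>) (Y (exit_min t \<omega>) \<omega>))"
      using AE_exit_time(1) AE_exit_time(2)[OF t] AE_space
    proof eventually_elim
      fix \<omega> assume *: "0 < T \<omega>" "T \<omega> \<noteq> ereal t" "\<omega> \<in> space M"
      show "(\<lambda>n. indicator {\<omega>. 0 < T \<omega> \<and> T \<omega> \<le> ereal t} \<omega> *
       (indicator {..b} (Y t \<omega>) - transition_cdf b (t - grid_stop t n \<omega>) (Y (grid_stop t n \<omega>) \<omega>)))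
      \<longlonglongrightarrow> indicator {\<omega>. T \<omega> \<le> ereal t} \<omega> *
     (indicator {..b} (Y t \<omega>) - transition_cdf b (t - exit_min t \<omega>) (Y (exit_min t \<omega>) \<omega>))"
      proof (cases "T \<omega> \<le> ereal t")
        case True
        then have "exit_min t \<omega> < t"
          using * exit_min_bounds[OF *(3), of t] t by (metis less_eq_real_def)
        then have "(\<lambda>n. transition_cdf b (t - grid_stop t n \<omega>) (Y (grid_stop t n \<omega>) \<omega>))
            \<longlonglongrightarrow> transition_cdf b (t - exit_min t \<omega>) (Y (exit_min t \<omega>) \<omega>)"
          by (intro tendsto_transition_cdf Y_grid_stop_tendsto tendsto_intros grid_stop_tendsto * t) simp
        then show ?thesis using True * by (auto intro!: tendsto_intros)
      qed simp
    qed
    show "AE \<omega> in M. norm (indicator {\<omega>. 0 < T \<omega> \<and> T \<omega> \<le> ereal t} \<omega> *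
       (indicator {..b} (Y t \<omega>) - transition_cdf b (t - grid_stop t n \<omega>) (Y (grid_stop t n \<omega>) \<omega>))) \<le> 1" for n
      using abs_indicator_diff_transition_cdf_le_1 by (auto split: split_indicator)
  qed measurable
  then show ?thesis
    unfolding strong_markov_grid[OF t] by (rule LIMSEQ_unique[OF _ tendsto_const])
qed

section \<open>The density of paths that have left the cone\<close>

abbreviation "\<kappa> \<equiv> exit_kernel W \<gamma> t0 y0"

definition exit_density :: "real \<Rightarrow> real \<Rightarrow> real" where
  "exit_density t y = (\<integral>\<omega>. \<kappa> t y \<omega> \<partial>M)"

definition free_density :: "real \<Rightarrow> real \<Rightarrow> real" where
  "free_density t = normal_density (y0 + \<gamma> * t) (sqrt t)"

lemma exit_kernel_eq:
  assumes "\<omega> \<in> space M" "0 < t"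
  shows "\<kappa> t y \<omega> = indicator {\<omega>. T \<omega> \<le> ereal t} \<omega> *
    normal_density (Y (exit_min t \<omega>) \<omega> + \<gamma> * (t - exit_min t \<omega>)) (sqrt (t - exit_min t \<omega>)) y"
proof (cases "T \<omega> \<le> ereal t")
  case True
  then have T: "T \<omega> = ereal (exit_min t \<omega>)" and "exit_min t \<omega> \<le> t"
    using exit_min_bounds[OF assms(1), of t] assms(2) by auto
  then show ?thesis
    by (simp add: exit_kernel_def normal_density_def Let_def diff_diff_eq)
qed (simp add: exit_kernel_def)

lemma exit_kernel_nonneg: "0 \<le> \<kappa> t y \<omega>"
proof (cases "T \<omega> \<le> ereal t")
  case True
  then have "real_of_ereal (T \<omega>) \<le> t \<or> T \<omega> = -\<infinity>" by (cases "T \<omega>") auto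
  moreover have "T \<omega> \<noteq> -\<infinity>"
  proof -
    have "0 \<le> T \<omega>" unfolding exit_time_def by (rule Inf_greatest) auto
    then show ?thesis by auto
  qed
  ultimately show ?thesis using True by (simp add: exit_kernel_def Let_def)
qed (simp add: exit_kernel_def)

lemma measurable_exit_kernel:
  assumes t: "0 < t"
  shows "case_prod (\<kappa> t) \<in> borel_measurable (lborel \<Otimes>\<^sub>M M)" "\<kappa> t y \<in> borel_measurable M"
proof -
  note [measurable] = measurable_Y_stop[OF t]
  have "(\<lambda>p. indicator {\<omega>. T \<omega> \<le> ereal t} (snd p) *
     normal_density (Y (exit_min t (snd p)) (snd p) + \<gamma> * (t - exit_min t (snd p))) (sqrt (t - exit_min t (snd p))) (fst p))
     \<in> borel_measurable (lborel \<Otimes>\<^sub>M M)"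
    unfolding normal_density_def by measurable
  then show *: "case_prod (\<kappa> t) \<in> borel_measurable (lborel \<Otimes>\<^sub>M M)"
    by (rule measurable_cong[THEN iffD2, rotated])
       (auto simp: space_pair_measure exit_kernel_eq[OF _ t])
  show "\<kappa> t y \<in> borel_measurable M"
    using measurable_compose[OF measurable_Pair1'[of y lborel M] *] by simp
qed

text \<open>The mean of the Gaussian kernel has distance at most \<open>(1 + \<bar>\<gamma>\<bar>) \<tau>\<close> from one of the points \<open>0\<close> and \<open>t0 + t\<close>,
  where \<open>\<tau>\<close> is its variance. So either the variance or the distance from \<open>y\<close> to the mean is bounded
  below, uniformly in the path.\<close>
lemma exit_kernel_bound:
  assumes t: "0 < t" and d: "0 < d"
  obtains B where "AE \<omega> in M. \<forall>y. d \<le> \<bar>y\<bar> \<longrightarrow> d \<le> \<bar>y - (t0 + t)\<bar> \<longrightarrow> \<kappa> t y \<omega> \<le> B"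
proof
  define g where "g = 1 + \<bar>\<gamma>\<bar>"
  have g: "0 < g" by (simp add: g_def)
  \<comment> \<open>If the variance is below \<open>d / (2 g)\<close>, the mean is within \<open>d / 2\<close> of a boundary point.\<close>
  define c where "c = min (d / (2 * g)) ((d / 2)\<^sup>2)"
  have c: "0 < c" using d g by (simp add: c_def)
  show "AE \<omega> in M. \<forall>y. d \<le> \<bar>y\<bar> \<longrightarrow> d \<le> \<bar>y - (t0 + t)\<bar> \<longrightarrow> \<kappa> t y \<omega> \<le> 1 / sqrt (2 * pi * c)"
    using AE_start AE_space
  proof eventually_elim
    fix \<omega> assume start: "Y 0 \<omega> = y0" and \<omega>: "\<omega> \<in> space M"
    show "\<forall>y. d \<le> \<bar>y\<bar> \<longrightarrow> d \<le> \<bar>y - (t0 + t)\<bar> \<longrightarrow> \<kappa> t y \<omega> \<le> 1 / sqrt (2 * pi * c)"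
    proof (intro allI impI)
      fix y assume y: "d \<le> \<bar>y\<bar>" "d \<le> \<bar>y - (t0 + t)\<bar>"
      show "\<kappa> t y \<omega> \<le> 1 / sqrt (2 * pi * c)"
      proof (cases "T \<omega> \<le> ereal t")
        case True
        define \<tau> where "\<tau> = t - exit_min t \<omega>"
        define m where "m = Y (exit_min t \<omega>) \<omega> + \<gamma> * \<tau>"
        have \<tau>: "0 \<le> \<tau>" and T: "T \<omega> = ereal (exit_min t \<omega>)"
          using exit_min_bounds[OF \<omega>, of t] t True by (auto simp: \<tau>_def)
        have \<gamma>\<tau>: "\<bar>\<gamma> * \<tau>\<bar> = \<bar>\<gamma>\<bar> * \<tau>" using \<tau> by (simp add: abs_mult)
        have "Y (exit_min t \<omega>) \<omega> = 0 \<or> Y (exit_min t \<omega>) \<omega> = t0 + t - \<tau>"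
          using exit_on_boundary(2)[OF \<omega> start T] by (auto simp: \<tau>_def)
        then have "d - g * \<tau> \<le> \<bar>y - m\<bar>"
          using y \<gamma>\<tau> \<tau> by (auto simp: m_def g_def distrib_right)
        then have "d / 2 \<le> \<bar>y - m\<bar>" if "\<tau> < d / (2 * g)"
          using that g by (simp add: field_simps)
        then have "(d / 2)\<^sup>2 \<le> (y - m)\<^sup>2" if "\<tau> < d / (2 * g)"
          using that d by (metis abs_le_square_iff abs_of_nonneg half_gt_zero less_imp_le)
        then have "c \<le> \<tau> + (y - m)\<^sup>2"
          using \<tau> zero_le_power2[of "y - m"] unfolding c_def by linarith
        then have "normal_density m (sqrt \<tau>) y \<le> 1 / sqrt (2 * pi * c)"
          using \<tau> c by (intro normal_density_le) auto
        then show ?thesis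
          using True by (simp add: exit_kernel_eq[OF \<omega> t] m_def \<tau>_def)
      qed (use c in \<open>simp add: exit_kernel_def\<close>)
    qed
  qed
qed

lemma integrable_exit_kernel:
  assumes t: "0 < t" and y: "y \<notin> {0, t0 + t}"
  shows "integrable M (\<kappa> t y)"
proof -
  define d where "d = min \<bar>y\<bar> \<bar>y - (t0 + t)\<bar>"
  have "0 < d" using y by (auto simp: d_def)
  then obtain B where "AE \<omega> in M. \<forall>y. d \<le> \<bar>y\<bar> \<longrightarrow> d \<le> \<bar>y - (t0 + t)\<bar> \<longrightarrow> \<kappa> t y \<omega> \<le> B"
    by (rule exit_kernel_bound[OF t])
  then have "AE \<omega> in M. norm (\<kappa> t y \<omega>) \<le> B"
    by eventually_elim (auto simp: exit_kernel_nonneg d_def)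
  then show ?thesis
    by (rule integrable_const_bound) (rule measurable_exit_kernel[OF t])
qed

lemma exit_density_nonneg: "0 \<le> exit_density t y"
  unfolding exit_density_def by (rule Bochner_Integration.integral_nonneg) (rule exit_kernel_nonneg)

lemma nn_integral_exit_kernel:
  assumes "0 < t" "y \<notin> {0, t0 + t}"
  shows "(\<integral>\<^sup>+\<omega>. ennreal (\<kappa> t y \<omega>) \<partial>M) = ennreal (exit_density t y)"
  unfolding exit_density_def
  by (intro nn_integral_eq_integral integrable_exit_kernel assms) (simp add: exit_kernel_nonneg)

lemma continuous_on_exit_density:
  assumes t: "0 < t"
  shows "continuous_on (- {0, t0 + t}) (exit_density t)"
proof (rule continuous_at_imp_continuous_on, rule ballI)
  fix y1 assume y1: "y1 \<in> - {0, t0 + t}"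
  \<comment> \<open>Half the distance to the boundary points, so that a ball of this radius keeps that distance.\<close>
  define d where "d = min \<bar>y1\<bar> \<bar>y1 - (t0 + t)\<bar> / 2"
  have d: "0 < d" using y1 by (auto simp: d_def)
  then obtain B where B: "AE \<omega> in M. \<forall>y. d \<le> \<bar>y\<bar> \<longrightarrow> d \<le> \<bar>y - (t0 + t)\<bar> \<longrightarrow> \<kappa> t y \<omega> \<le> B"
    by (rule exit_kernel_bound[OF t])
  let ?S = "ball y1 d"
  have away: "d \<le> \<bar>y\<bar>" "d \<le> \<bar>y - (t0 + t)\<bar>" if "y \<in> ?S" for y
  proof -
    have "\<bar>y1 - y\<bar> < d" "2 * d \<le> \<bar>y1\<bar>" "2 * d \<le> \<bar>y1 - (t0 + t)\<bar>"
      using that by (auto simp: d_def dist_real_def)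
    then show "d \<le> \<bar>y\<bar>" "d \<le> \<bar>y - (t0 + t)\<bar>" by linarith+
  qed
  have "continuous_on ?S (exit_density t)"
    unfolding continuous_on_sequentially
  proof (intro allI ballI impI)
    fix x :: "nat \<Rightarrow> real" and a assume a: "a \<in> ?S" and x: "(\<forall>n. x n \<in> ?S) \<and> x \<longlonglongrightarrow> a"
    show "(exit_density t \<circ> x) \<longlonglongrightarrow> exit_density t a"
      unfolding comp_def exit_density_def
    proof (rule integral_dominated_convergence[where w="\<lambda>_. B"])
      show "AE \<omega> in M. (\<lambda>n. \<kappa> t (x n) \<omega>) \<longlonglongrightarrow> \<kappa> t a \<omega>"
      proof (rule AE_I2)
        fix \<omega> assume \<omega>: "\<omega> \<in> space M"
        show "(\<lambda>n. \<kappa> t (x n) \<omega>) \<longlonglongrightarrow> \<kappa> t a \<omega>"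
          unfolding exit_kernel_eq[OF \<omega> t]
          using x by (intro tendsto_mult tendsto_const
              continuous_on_tendsto_compose[OF continuous_on_normal_density[of UNIV]]) auto
      qed
      show "AE \<omega> in M. norm (\<kappa> t (x n) \<omega>) \<le> B" for n
        using B by eventually_elim (use x away in \<open>auto simp: exit_kernel_nonneg\<close>)
    qed (auto intro: measurable_exit_kernel[OF t])
  qed
  then show "isCont (exit_density t) y1"
    using d by (auto simp: continuous_on_eq_continuous_at)
qed

lemma measurable_exit_density: "0 < t \<Longrightarrow> exit_density t \<in> borel_measurable borel"
  unfolding exit_density_def
  using borel_measurable_lebesgue_integral[of "\<kappa> t" lborel] measurable_exit_kernel(1) by simp

text \<open>The strong Markov property at \<open>T\<close>, with the distribution function written as the integral of its density
  and the integrals exchanged.\<close>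
lemma emeasure_exited_atMost:
  assumes t: "0 < t"
  shows "emeasure M {\<omega>\<in>space M. Y t \<omega> \<le> b \<and> T \<omega> \<le> ereal t}
    = (\<integral>\<^sup>+y. (\<integral>\<^sup>+\<omega>. ennreal (\<kappa> t y \<omega>) \<partial>M) * indicator {..b} y \<partial>lborel)"
proof -
  have [measurable]: "Y t \<in> borel_measurable M" using t by (auto intro: measurable_Y)
  note [measurable] = measurable_Y_stop[OF t] measurable_exit_kernel(1)[OF t]
  interpret lM: pair_sigma_finite lborel M
    by (intro pair_sigma_finite.intro sigma_finite_lborel sigma_finite_measure_axioms)
  let ?o = "\<lambda>\<omega>. transition_cdf b (t - exit_min t \<omega>) (Y (exit_min t \<omega>) \<omega>)"
  have int: "integrable M (\<lambda>\<omega>. indicator {\<omega>. T \<omega> \<le> ereal t} \<omega> * ?o \<omega>)"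
    by (intro integrable_const_bound[where B=1])
       (auto simp: transition_cdf_nonneg transition_cdf_le_1 split: split_indicator)
  have int': "integrable M (\<lambda>\<omega>. indicator {\<omega>. T \<omega> \<le> ereal t} \<omega> * indicator {..b} (Y t \<omega>) :: real)"
    by (intro integrable_const_bound[where B=1]) (auto split: split_indicator)
  have "measure M {\<omega>\<in>space M. Y t \<omega> \<le> b \<and> T \<omega> \<le> ereal t}
      = (\<integral>\<omega>. indicator {\<omega>\<in>space M. Y t \<omega> \<le> b \<and> T \<omega> \<le> ereal t} \<omega> \<partial>M)"
    by simp
  also have "\<dots> = (\<integral>\<omega>. indicator {\<omega>. T \<omega> \<le> ereal t} \<omega> * indicator {..b} (Y t \<omega>) \<partial>M)"
    by (intro Bochner_Integration.integral_cong) (auto split: split_indicator)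
  also have "\<dots> = (\<integral>\<omega>. indicator {\<omega>. T \<omega> \<le> ereal t} \<omega> * ?o \<omega> \<partial>M)"
    using strong_markov_exit[OF t, of b] unfolding right_diff_distrib Bochner_Integration.integral_diff[OF int' int]
    by simp
  finally have "emeasure M {\<omega>\<in>space M. Y t \<omega> \<le> b \<and> T \<omega> \<le> ereal t}
      = ennreal (\<integral>\<omega>. indicator {\<omega>. T \<omega> \<le> ereal t} \<omega> * ?o \<omega> \<partial>M)"
    by (simp add: emeasure_eq_measure)
  also have "\<dots> = (\<integral>\<^sup>+\<omega>. ennreal (indicator {\<omega>. T \<omega> \<le> ereal t} \<omega> * ?o \<omega>) \<partial>M)"
    by (rule nn_integral_eq_integral[symmetric, OF int]) (simp add: transition_cdf_nonneg)
  also have "\<dots> = (\<integral>\<^sup>+\<omega>. (\<integral>\<^sup>+y. ennreal (\<kappa> t y \<omega>) * indicator {..b} y \<partial>lborel) \<partial>M)"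
  proof (rule nn_integral_cong_AE)
    show "AE \<omega> in M. ennreal (indicator {\<omega>. T \<omega> \<le> ereal t} \<omega> * ?o \<omega>)
        = (\<integral>\<^sup>+y. ennreal (\<kappa> t y \<omega>) * indicator {..b} y \<partial>lborel)"
      using AE_exit_time(2)[OF t] AE_space
    proof eventually_elim
      fix \<omega> assume *: "T \<omega> \<noteq> ereal t" and \<omega>: "\<omega> \<in> space M"
      show "ennreal (indicator {\<omega>. T \<omega> \<le> ereal t} \<omega> * ?o \<omega>)
        = (\<integral>\<^sup>+y. ennreal (\<kappa> t y \<omega>) * indicator {..b} y \<partial>lborel)"
      proof (cases "T \<omega> \<le> ereal t")
        case True
        then have "exit_min t \<omega> < t"
          using * exit_min_bounds[OF \<omega>, of t] t by (metis less_eq_real_def)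
        then show ?thesis
          using True by (simp add: exit_kernel_eq[OF \<omega> t] emeasure_normal_atMost transition_cdf_def diff_diff_eq)
      qed (simp add: exit_kernel_def)
    qed
  qed
  also have "\<dots> = (\<integral>\<^sup>+y. (\<integral>\<^sup>+\<omega>. ennreal (\<kappa> t y \<omega>) * indicator {..b} y \<partial>M) \<partial>lborel)"
    by (rule lM.Fubini') measurable
  also have "\<dots> = (\<integral>\<^sup>+y. (\<integral>\<^sup>+\<omega>. ennreal (\<kappa> t y \<omega>) \<partial>M) * indicator {..b} y \<partial>lborel)"
    using measurable_exit_kernel(2)[OF t] by (intro nn_integral_cong nn_integral_multc) measurable
  finally show ?thesis .
qed

lemma emeasure_exited:
  assumes t: "0 < t" and A: "A \<in> sets borel"
  shows "emeasure M {\<omega>\<in>space M. Y t \<omega> \<in> A \<and> T \<omega> \<le> ereal t}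
    = (\<integral>\<^sup>+y. ennreal (exit_density t y) * indicator A y \<partial>lborel)"
proof -
  have [measurable]: "Y t \<in> borel_measurable M" using t by (auto intro: measurable_Y)
  note [measurable] = measurable_exit_density[OF t] A
  let ?\<mu> = "distr (density M (indicator {\<omega>\<in>space M. T \<omega> \<le> ereal t})) borel (Y t)"
  let ?\<nu> = "density lborel (\<lambda>y. ennreal (exit_density t y))"
  have \<mu>: "emeasure ?\<mu> B = emeasure M {\<omega>\<in>space M. Y t \<omega> \<in> B \<and> T \<omega> \<le> ereal t}"
    if [measurable]: "B \<in> sets borel" for B
  proof -
    have "emeasure ?\<mu> B = (\<integral>\<^sup>+\<omega>. indicator {\<omega>\<in>space M. T \<omega> \<le> ereal t} \<omega> * indicator (Y t -` B \<inter> space M) \<omega> \<partial>M)"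
      by (subst emeasure_distr) (auto simp: emeasure_density)
    also have "\<dots> = (\<integral>\<^sup>+\<omega>. indicator {\<omega>\<in>space M. Y t \<omega> \<in> B \<and> T \<omega> \<le> ereal t} \<omega> \<partial>M)"
      by (intro nn_integral_cong) (auto split: split_indicator)
    finally show ?thesis by simp
  qed
  have AE_y: "AE y in lborel. y \<notin> {0, t0 + t}"
    using AE_lborel_singleton[of 0] AE_lborel_singleton[of "t0 + t"] by eventually_elim auto
  have eq: "emeasure ?\<mu> {..b} = emeasure ?\<nu> {..b}" for b
  proof -
    have "emeasure ?\<nu> {..b} = (\<integral>\<^sup>+y. ennreal (exit_density t y) * indicator {..b} y \<partial>lborel)"
      by (subst emeasure_density) auto
    also have "\<dots> = (\<integral>\<^sup>+y. (\<integral>\<^sup>+\<omega>. ennreal (\<kappa> t y \<omega>) \<partial>M) * indicator {..b} y \<partial>lborel)"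
      by (intro nn_integral_cong_AE eventually_mono[OF AE_y]) (simp add: nn_integral_exit_kernel[OF t])
    finally show ?thesis by (simp add: \<mu> emeasure_exited_atMost[OF t])
  qed
  have "?\<mu> = ?\<nu>"
  proof (rule measure_eqI_generator_eq[where \<Omega>=UNIV and E="range atMost" and A="\<lambda>n. {..real n}"])
    show "Int_stable (range (atMost :: real \<Rightarrow> _))"
      by (auto simp: Int_stable_def)
    show "(\<Union>n. {..real n}) = UNIV"
      by (auto intro: real_arch_simple)
    show "emeasure ?\<mu> {..real n} \<noteq> \<infinity>" for n
      by (simp add: \<mu> emeasure_eq_measure)
    show "sets ?\<mu> = sigma_sets UNIV (range atMost)" "sets ?\<nu> = sigma_sets UNIV (range atMost)"
      by (simp_all add: borel_eq_atMost)
  qed (auto simp: eq)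
  then have "emeasure ?\<mu> A = emeasure ?\<nu> A" by simp
  then show ?thesis by (simp add: \<mu> emeasure_density)
qed

lemma distributed_Y:
  assumes t: "0 < t"
  shows "distributed M lborel (Y t) (\<lambda>y. ennreal (free_density t y))"
proof -
  have [measurable]: "Y t \<in> borel_measurable M" "W t \<in> borel_measurable M" "W 0 \<in> borel_measurable M"
    using t by (auto intro: measurable_Y measurable_W)
  have "distributed M lborel (\<lambda>\<omega>. W t \<omega> - W 0 \<omega>) (normal_density 0 (sqrt t))"
    using gaussian_increments[of 0 t] t by simp
  then have "distributed M lborel (\<lambda>\<omega>. (y0 + \<gamma> * t) + 1 * (W t \<omega> - W 0 \<omega>))
      (normal_density ((y0 + \<gamma> * t) + 1 * 0) (\<bar>1\<bar> * sqrt t))"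
    by (rule normal_density_affine) (use t in auto)
  then have D: "distributed M lborel (\<lambda>\<omega>. y0 + \<gamma> * t + (W t \<omega> - W 0 \<omega>)) (\<lambda>y. ennreal (free_density t y))"
    by (simp add: free_density_def)
  have "distr M lborel (Y t) = distr M lborel (\<lambda>\<omega>. y0 + \<gamma> * t + (W t \<omega> - W 0 \<omega>))"
    by (rule distr_cong_AE) (use start_zero in \<open>auto simp: drifted_def\<close>)
  then show ?thesis using D by (simp add: distributed_def)
qed

lemma integrable_free_density: "0 < t \<Longrightarrow> integrable lborel (free_density t)"
  by (simp add: free_density_def)

lemma integrable_exit_density:
  assumes t: "0 < t" shows "integrable lborel (exit_density t)"
proof (rule integrableI_nonneg)
  show "exit_density t \<in> borel_measurable lborel" using measurable_exit_density[OF t] by simp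
  have "(\<integral>\<^sup>+y. ennreal (exit_density t y) \<partial>lborel) = emeasure M {\<omega>\<in>space M. Y t \<omega> \<in> UNIV \<and> T \<omega> \<le> ereal t}"
    by (subst emeasure_exited[OF t]) auto
  also have "\<dots> < \<infinity>" by (simp add: emeasure_eq_measure)
  finally show "(\<integral>\<^sup>+y. ennreal (exit_density t y) \<partial>lborel) < \<infinity>" .
qed (simp add: exit_density_nonneg)

lemma prob_not_exited:
  assumes t: "0 < t" and A [measurable]: "A \<in> sets borel"
  shows "measure M {\<omega>\<in>space M. Y t \<omega> \<in> A \<and> ereal t < T \<omega>}
    = (LINT y:A|lborel. free_density t y - exit_density t y)"
proof -
  have [measurable]: "Y t \<in> borel_measurable M" using t by (auto intro: measurable_Y)
  have int: "integrable lborel (\<lambda>y. indicator A y * f y)" if "integrable lborel f" for f :: "real \<Rightarrow> real"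
    using integrable_mult_indicator[OF _ that, of A] by simp
  have nn: "measure M E = (LINT y:A|lborel. f y)"
    if "emeasure M E = (\<integral>\<^sup>+y. ennreal (f y) * indicator A y \<partial>lborel)" "integrable lborel f" "\<And>y. 0 \<le> f y"
    for E f
  proof -
    have "emeasure M E = (\<integral>\<^sup>+y. ennreal (indicator A y * f y) \<partial>lborel)"
      unfolding that(1) by (intro nn_integral_cong) (simp split: split_indicator)
    also have "\<dots> = ennreal (\<integral>y. indicator A y * f y \<partial>lborel)"
      by (intro nn_integral_eq_integral int that) (simp add: that)
    finally show ?thesis
      using that(3) by (simp add: measure_def set_lebesgue_integral_def integral_nonneg_AE)
  qed
  have "emeasure M (Y t -` A \<inter> space M) = (\<integral>\<^sup>+y. ennreal (free_density t y) * indicator A y \<partial>lborel)"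
    by (rule distributed_emeasure[OF distributed_Y[OF t]]) simp
  then have free: "measure M (Y t -` A \<inter> space M) = (LINT y:A|lborel. free_density t y)"
    by (rule nn[OF _ integrable_free_density[OF t]]) (simp add: free_density_def)
  have exited: "measure M {\<omega>\<in>space M. Y t \<omega> \<in> A \<and> T \<omega> \<le> ereal t} = (LINT y:A|lborel. exit_density t y)"
    by (rule nn[OF emeasure_exited[OF t A] integrable_exit_density[OF t] exit_density_nonneg])
  have "{\<omega>\<in>space M. Y t \<omega> \<in> A \<and> ereal t < T \<omega>}
      = (Y t -` A \<inter> space M) - {\<omega>\<in>space M. Y t \<omega> \<in> A \<and> T \<omega> \<le> ereal t}"
    by (auto simp: not_le)
  then have "measure M {\<omega>\<in>space M. Y t \<omega> \<in> A \<and> ereal t < T \<omega>}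
      = measure M (Y t -` A \<inter> space M) - measure M {\<omega>\<in>space M. Y t \<omega> \<in> A \<and> T \<omega> \<le> ereal t}"
    by (simp only:) (rule finite_measure_Diff; auto)
  also have "\<dots> = (LINT y:A|lborel. free_density t y - exit_density t y)"
    unfolding free exited set_lebesgue_integral_def
    by (simp add: right_diff_distrib int integrable_free_density integrable_exit_density t)
  finally show ?thesis .
qed

section \<open>Image charges\<close>

text \<open>On \<open>t < T\<close> the motion lies in the section of the cone, so the killed density vanishes almost everywhere
  outside, and by continuity everywhere outside the closed section.\<close>
lemma exit_density_outside:
  assumes t: "0 < t" and z: "z \<notin> {0..t0 + t}"
  shows "exit_density t z = free_density t z"
proof -
  have "free_density t z - exit_density t z = 0"
  proof (rule continuous_density_unique[where U="- {0..t0 + t}" and g="\<lambda>_. 0"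
        and f="\<lambda>z. free_density t z - exit_density t z"])
    show "continuous_on (- {0..t0 + t}) (\<lambda>z. free_density t z - exit_density t z)"
      unfolding free_density_def
      by (intro continuous_intros continuous_on_normal_density continuous_on_subset[OF continuous_on_exit_density[OF t]])
         (use t y0_pos y0_less in auto)
    fix A :: "real set" assume A: "A \<in> sets borel" "A \<subseteq> - {0..t0 + t}"
    have "\<not> (Y t \<omega> \<in> A \<and> ereal t < T \<omega>)" if "\<omega> \<in> space M" for \<omega>
    proof
      assume *: "Y t \<omega> \<in> A \<and> ereal t < T \<omega>"
      then have "0 < Y t \<omega> \<and> Y t \<omega> < t0 + t"
        using exit_time_gt_iff[OF that, of t] t by auto
      then show False using * A(2) by auto
    qed
    then have empty: "{\<omega>\<in>space M. Y t \<omega> \<in> A \<and> ereal t < T \<omega>} = {}" by auto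
    show "(LINT y:A|lborel. free_density t y - exit_density t y) = (LINT y:A|lborel. 0)"
      using prob_not_exited[OF t A(1)] unfolding empty by (simp add: set_lebesgue_integral_def)
  qed (use z in \<open>auto intro!: Bochner_Integration.integrable_diff integrable_free_density integrable_exit_density t\<close>)
  then show ?thesis by simp
qed

text \<open>The image charges. The poles are obtained from \<open>y\<close> by repeated reflection at \<open>0\<close> and at \<open>t0 + t\<close>;
  the weights are quadratic exponentials because the upper boundary moves with unit speed.\<close>
definition pole :: "real \<Rightarrow> real \<Rightarrow> int \<Rightarrow> real" where
  "pole t y n = y - 2 * of_int n * (t0 + t)"

definition weight :: "real \<Rightarrow> real \<Rightarrow> int \<Rightarrow> real" where
  "weight t y n = exp (2 * (of_int n)\<^sup>2 * (t0 + t) - 2 * of_int n * y)"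

text \<open>The contribution of the pole \<open>n\<close>, respectively of its mirror image, for a function \<open>f\<close> of the endpoint. The
  factors \<open>exp (\<gamma> (y - z))\<close> remove the drift and are normalised to be \<open>1\<close> at \<open>z = y\<close>.\<close>
definition source :: "real \<Rightarrow> real \<Rightarrow> (real \<Rightarrow> real) \<Rightarrow> int \<Rightarrow> real" where
  "source t y f n = weight t y n * (exp (\<gamma> * (y - pole t y n)) * f (pole t y n))"

definition sink :: "real \<Rightarrow> real \<Rightarrow> (real \<Rightarrow> real) \<Rightarrow> int \<Rightarrow> real" where
  "sink t y f n = weight t y n * (exp (\<gamma> * (y - (- pole t y n))) * f (- pole t y n))"

lemma pole_0 [simp]: "pole t y 0 = y" and weight_0 [simp]: "weight t y 0 = 1"
  by (simp_all add: pole_def weight_def)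

lemma poles_outside:
  assumes "0 < y" "y < L" "L = t0 + t"
  shows "n \<noteq> 0 \<Longrightarrow> pole t y n \<notin> {0..L}" "- pole t y n \<notin> {0..L}"
proof -
  define m where "m = of_int n * L"
  have p: "pole t y n = y - 2 * m" using assms by (simp add: pole_def m_def)
  have L: "0 < L" using assms by simp
  have up: "L \<le> m" if "1 \<le> n"
    using mult_right_mono[of 1 "of_int n" L] that L unfolding m_def by simp
  have down: "m \<le> of_int k * L" if "n \<le> k" for k
    using mult_right_mono[of "of_int n" "of_int k" L] that L unfolding m_def by simp
  have "n \<le> 0 \<or> 1 \<le> n" by linarith
  then show "- pole t y n \<notin> {0..L}"
    using up down[of 0] assms(1,2) unfolding p by auto
  assume "n \<noteq> 0"
  then have "n \<le> -1 \<or> 1 \<le> n" by linarith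
  then show "pole t y n \<notin> {0..L}"
    using up down[of "-1"] assms(1,2) unfolding p by auto
qed

text \<open>The cancellation on the moving boundary: with \<open>q = y - (2 n + 1) (t0 + t)\<close> the two distances to the poles
  are \<open>q + \<tau>\<close> and \<open>q - \<tau>\<close> up to sign, and the difference \<open>4 q \<tau>\<close> of their squares is what the quotient of
  the weights compensates.\<close>
lemma reflect_pole:
  assumes "0 < \<tau>" "x = t0 + t - \<tau>"
  shows "weight t y n * normal_density x (sqrt \<tau>) (pole t y n)
    = weight t y (n + 1) * normal_density x (sqrt \<tau>) (- pole t y (n + 1))"
proof -
  have "2 * (of_int n)\<^sup>2 * (t0 + t) - 2 * of_int n * y + - (pole t y n - x)\<^sup>2 / (2 * \<tau>)
    = 2 * (of_int (n + 1))\<^sup>2 * (t0 + t) - 2 * of_int (n + 1) * y + - (- pole t y (n + 1) - x)\<^sup>2 / (2 * \<tau>)"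
    unfolding assms(2) pole_def using assms(1)
    by (simp add: field_simps power2_eq_square)
  then have "weight t y n * exp (- (pole t y n - x)\<^sup>2 / (2 * \<tau>))
      = weight t y (n + 1) * exp (- (- pole t y (n + 1) - x)\<^sup>2 / (2 * \<tau>))"
    unfolding weight_def by (simp only: exp_add[symmetric])
  then show ?thesis
    using assms(1) by (simp add: normal_density_def)
qed

text \<open>The sums are taken in the extended nonnegative reals, where reindexing is unconditional; convergence
  plays a role only after taking expectations.\<close>
lemma source_eq_sink_exit_kernel:
  assumes \<omega>: "\<omega> \<in> space M" and t: "0 < t" and start: "Y 0 \<omega> = y0" and neq: "T \<omega> \<noteq> ereal t"
  shows "(\<integral>\<^sup>+n. ennreal (source t y (\<lambda>z. \<kappa> t z \<omega>) n) \<partial>count_space UNIV)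
    = (\<integral>\<^sup>+n. ennreal (sink t y (\<lambda>z. \<kappa> t z \<omega>) n) \<partial>count_space UNIV)"
proof (cases "T \<omega> \<le> ereal t")
  case False
  then show ?thesis by (simp add: source_def sink_def exit_kernel_def)
next
  case True
  define \<tau> where "\<tau> = t - exit_min t \<omega>"
  define x where "x = Y (exit_min t \<omega>) \<omega>"
  define c where "c = exp (\<gamma> * (y - x) - \<gamma>\<^sup>2 * \<tau> / 2)"
  have T: "T \<omega> = ereal (exit_min t \<omega>)" and "exit_min t \<omega> \<le> t"
    using exit_min_bounds[OF \<omega>, of t] t True by auto
  then have \<tau>: "0 < \<tau>" using neq by (auto simp: \<tau>_def less_le)
  have \<kappa>: "exp (\<gamma> * (y - z)) * \<kappa> t z \<omega> = c * normal_density x (sqrt \<tau>) z" for z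
    using True normal_density_tilt[OF \<tau>, of \<gamma> y z x]
    by (simp add: exit_kernel_eq[OF \<omega> t] \<tau>_def[symmetric] x_def[symmetric] c_def)
  have source: "source t y (\<lambda>z. \<kappa> t z \<omega>) n = c * (weight t y n * normal_density x (sqrt \<tau>) (pole t y n))"
    and sink: "sink t y (\<lambda>z. \<kappa> t z \<omega>) n = c * (weight t y n * normal_density x (sqrt \<tau>) (- pole t y n))" for n
    by (simp_all only: source_def sink_def \<kappa> mult_ac)
  have "x = 0 \<or> x = t0 + t - \<tau>"
    using exit_on_boundary(2)[OF \<omega> start T] by (auto simp: x_def \<tau>_def)
  then show ?thesis
  proof
    assume "x = 0"
    then show ?thesis
      by (intro nn_integral_cong) (simp add: source sink normal_density_def)
  next
    assume x: "x = t0 + t - \<tau>"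
    have "bij (\<lambda>n::int. n + 1)"
      by (rule bij_betw_byWitness[where f'="\<lambda>n. n - 1"]) auto
    then have "(\<integral>\<^sup>+n. ennreal (sink t y (\<lambda>z. \<kappa> t z \<omega>) n) \<partial>count_space UNIV)
        = (\<integral>\<^sup>+n. ennreal (sink t y (\<lambda>z. \<kappa> t z \<omega>) (n + 1)) \<partial>count_space UNIV)"
      by (rule nn_integral_bij_count_space[symmetric])
    also have "\<dots> = (\<integral>\<^sup>+n. ennreal (source t y (\<lambda>z. \<kappa> t z \<omega>) n) \<partial>count_space UNIV)"
      by (simp only: source sink reflect_pole[OF \<tau> x])
    finally show ?thesis by simp
  qed
qed

lemma source_eq_sink_exit_density:
  assumes t: "0 < t" and y: "0 < y" "y < t0 + t"
  shows "(\<integral>\<^sup>+n. ennreal (source t y (exit_density t) n) \<partial>count_space UNIV)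
    = (\<integral>\<^sup>+n. ennreal (sink t y (exit_density t) n) \<partial>count_space UNIV)"
proof -
  note [measurable] = measurable_exit_kernel(2)[OF t]
  have pole: "pole t y n \<notin> {0, t0 + t}" "- pole t y n \<notin> {0, t0 + t}" for n
  proof -
    show "- pole t y n \<notin> {0, t0 + t}"
      using poles_outside(2)[OF y refl, of n] y by auto
    show "pole t y n \<notin> {0, t0 + t}"
      using poles_outside(1)[OF y refl, of n] y by (cases "n = 0") auto
  qed
  have E: "(\<integral>\<^sup>+\<omega>. ennreal (a * (b * \<kappa> t z \<omega>)) \<partial>M) = ennreal (a * (b * exit_density t z))"
    if "0 \<le> a" "0 \<le> b" "z \<notin> {0, t0 + t}" for a b z
  proof -
    have "(\<integral>\<^sup>+\<omega>. ennreal (a * (b * \<kappa> t z \<omega>)) \<partial>M) = (\<integral>\<^sup>+\<omega>. ennreal (a * b) * ennreal (\<kappa> t z \<omega>) \<partial>M)"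
      using that by (simp add: ennreal_mult[symmetric] exit_kernel_nonneg mult.assoc)
    also have "\<dots> = ennreal (a * b) * ennreal (exit_density t z)"
      using that by (subst nn_integral_cmult) (auto simp: nn_integral_exit_kernel[OF t])
    finally show ?thesis
      using that by (simp add: ennreal_mult[symmetric] exit_density_nonneg mult.assoc)
  qed
  have "(\<integral>\<^sup>+n. ennreal (source t y (exit_density t) n) \<partial>count_space UNIV)
      = (\<integral>\<^sup>+n. (\<integral>\<^sup>+\<omega>. ennreal (source t y (\<lambda>z. \<kappa> t z \<omega>) n) \<partial>M) \<partial>count_space UNIV)"
    unfolding source_def by (subst E[OF _ _ pole(1)]) (simp_all add: weight_def)
  also have "\<dots> = (\<integral>\<^sup>+\<omega>. (\<integral>\<^sup>+n. ennreal (source t y (\<lambda>z. \<kappa> t z \<omega>) n) \<partial>count_space UNIV) \<partial>M)"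
    by (rule nn_integral_count_space_nn_integral[symmetric]) (auto simp: source_def)
  also have "\<dots> = (\<integral>\<^sup>+\<omega>. (\<integral>\<^sup>+n. ennreal (sink t y (\<lambda>z. \<kappa> t z \<omega>) n) \<partial>count_space UNIV) \<partial>M)"
  proof (rule nn_integral_cong_AE)
    show "AE \<omega> in M. (\<integral>\<^sup>+n. ennreal (source t y (\<lambda>z. \<kappa> t z \<omega>) n) \<partial>count_space UNIV)
        = (\<integral>\<^sup>+n. ennreal (sink t y (\<lambda>z. \<kappa> t z \<omega>) n) \<partial>count_space UNIV)"
      using AE_start AE_space AE_exit_time(2)[OF t]
      by eventually_elim (rule source_eq_sink_exit_kernel[OF _ t])
  qed
  also have "\<dots> = (\<integral>\<^sup>+n. (\<integral>\<^sup>+\<omega>. ennreal (sink t y (\<lambda>z. \<kappa> t z \<omega>) n) \<partial>M) \<partial>count_space UNIV)"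
    by (rule nn_integral_count_space_nn_integral) (auto simp: sink_def)
  also have "\<dots> = (\<integral>\<^sup>+n. ennreal (sink t y (exit_density t) n) \<partial>count_space UNIV)"
    unfolding sink_def by (subst E[OF _ _ pole(2)]) (simp_all add: weight_def)
  finally show ?thesis .
qed

text \<open>The weights depend on the final height \<open>t0 + t\<close> of the cone, the terms of the series on the initial
  height \<open>t0\<close>. Expanding the squares shows that the exponents coincide.\<close>
lemma source_free_density:
  assumes t: "0 < t"
  shows "source t y (free_density t) n = 1 / sqrt (2 * pi * t) *
    (exp (- ((y - 2 * of_int n * t0 - y0 - \<gamma> * t)\<^sup>2) / (2 * t) + \<gamma> * (2 * of_int n * t0 + y0))
     * exp (- \<gamma> * y0 - 2 * (of_int n)\<^sup>2 * t0 - 2 * of_int n * y0))"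
proof -
  have "2 * (of_int n)\<^sup>2 * (t0 + t) - 2 * of_int n * y + (\<gamma> * (y - pole t y n) + - (pole t y n - (y0 + \<gamma> * t))\<^sup>2 / (2 * t))
    = - ((y - 2 * of_int n * t0 - y0 - \<gamma> * t)\<^sup>2) / (2 * t) + \<gamma> * (2 * of_int n * t0 + y0)
      + (- \<gamma> * y0 - 2 * (of_int n)\<^sup>2 * t0 - 2 * of_int n * y0)"
    unfolding pole_def using t by (simp add: field_simps power2_eq_square)
  then have "weight t y n * (exp (\<gamma> * (y - pole t y n)) * exp (- (pole t y n - (y0 + \<gamma> * t))\<^sup>2 / (2 * t)))
    = exp (- ((y - 2 * of_int n * t0 - y0 - \<gamma> * t)\<^sup>2) / (2 * t) + \<gamma> * (2 * of_int n * t0 + y0))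
     * exp (- \<gamma> * y0 - 2 * (of_int n)\<^sup>2 * t0 - 2 * of_int n * y0)"
    unfolding weight_def by (simp only: exp_add[symmetric])
  then show ?thesis
    using t by (simp add: source_def free_density_def normal_density_def)
qed

text \<open>The series pairs the source \<open>n\<close> with the sink \<open>- n\<close>.\<close>
lemma sink_free_density:
  assumes t: "0 < t"
  shows "sink t y (free_density t) (- n) = 1 / sqrt (2 * pi * t) *
    (exp (- ((y + 2 * of_int n * t0 + y0 - \<gamma> * t)\<^sup>2) / (2 * t) - \<gamma> * (2 * of_int n * t0 + y0))
     * exp (- \<gamma> * y0 - 2 * (of_int n)\<^sup>2 * t0 - 2 * of_int n * y0))"
proof -
  have "2 * (of_int (- n))\<^sup>2 * (t0 + t) - 2 * of_int (- n) * y
      + (\<gamma> * (y - (- pole t y (- n))) + - (- pole t y (- n) - (y0 + \<gamma> * t))\<^sup>2 / (2 * t))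
    = - ((y + 2 * of_int n * t0 + y0 - \<gamma> * t)\<^sup>2) / (2 * t) - \<gamma> * (2 * of_int n * t0 + y0)
      + (- \<gamma> * y0 - 2 * (of_int n)\<^sup>2 * t0 - 2 * of_int n * y0)"
    unfolding pole_def using t by (simp add: field_simps power2_eq_square)
  then have "weight t y (- n) * (exp (\<gamma> * (y - (- pole t y (- n)))) * exp (- (- pole t y (- n) - (y0 + \<gamma> * t))\<^sup>2 / (2 * t)))
    = exp (- ((y + 2 * of_int n * t0 + y0 - \<gamma> * t)\<^sup>2) / (2 * t) - \<gamma> * (2 * of_int n * t0 + y0))
     * exp (- \<gamma> * y0 - 2 * (of_int n)\<^sup>2 * t0 - 2 * of_int n * y0)"
    unfolding weight_def by (simp only: exp_add[symmetric])
  then show ?thesis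
    using t by (simp add: sink_def free_density_def normal_density_def)
qed

lemma image_term_eq:
  assumes t: "0 < t"
  shows "1 / sqrt (2 * pi * t) * image_term \<gamma> t0 y0 t y n
    = source t y (free_density t) n - sink t y (free_density t) (- n)"
  unfolding image_term_def source_free_density[OF t] sink_free_density[OF t]
  by (simp only: left_diff_distrib right_diff_distrib)

lemma summable_free_density:
  assumes t: "0 < t"
  shows "source t y (free_density t) summable_on UNIV" "sink t y (free_density t) summable_on UNIV"
proof -
  define A where "A = 2 * t0\<^sup>2 / t + 2 * t0"
  have A: "0 < A" using t y0_pos y0_less by (simp add: A_def add_nonneg_pos)
  define v where "v = y - y0 - \<gamma> * t"
  have src: "source t y (free_density t) n = 1 / sqrt (2 * pi * t) * exp (- (A * (of_int n)\<^sup>2)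
      + (2 * v * t0 / t + 2 * \<gamma> * t0 - 2 * y0) * of_int n + - v\<^sup>2 / (2 * t))"
    for n
  proof -
    have y: "y = v + y0 + \<gamma> * t" by (simp add: v_def)
    have "- ((y - 2 * of_int n * t0 - y0 - \<gamma> * t)\<^sup>2) / (2 * t) + \<gamma> * (2 * of_int n * t0 + y0)
        + (- \<gamma> * y0 - 2 * (of_int n)\<^sup>2 * t0 - 2 * of_int n * y0)
      = - (A * (of_int n)\<^sup>2) + (2 * v * t0 / t + 2 * \<gamma> * t0 - 2 * y0) * of_int n + - v\<^sup>2 / (2 * t)"
      unfolding A_def y using t by (simp add: field_simps power2_eq_square)
    then show ?thesis by (simp only: source_free_density[OF t] exp_add[symmetric])
  qed
  have "source t y (free_density t) = (\<lambda>n. 1 / sqrt (2 * pi * t) * exp (- (A * (of_int n)\<^sup>2)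
      + (2 * v * t0 / t + 2 * \<gamma> * t0 - 2 * y0) * of_int n + - v\<^sup>2 / (2 * t)))"
    by (rule ext) (rule src)
  then show "source t y (free_density t) summable_on UNIV"
    by (simp only:) (intro summable_on_cmult_right summable_on_gaussian_int A)
  define u where "u = y + y0 - \<gamma> * t"
  have snk: "sink t y (free_density t) (- n) = 1 / sqrt (2 * pi * t) * exp (- (A * (of_int n)\<^sup>2)
      + (- 2 * u * t0 / t - 2 * \<gamma> * t0 - 2 * y0) * of_int n + (- u\<^sup>2 / (2 * t) - 2 * \<gamma> * y0))"
    for n
  proof -
    have y: "y = u - y0 + \<gamma> * t" by (simp add: u_def)
    have "- ((y + 2 * of_int n * t0 + y0 - \<gamma> * t)\<^sup>2) / (2 * t) - \<gamma> * (2 * of_int n * t0 + y0)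
        + (- \<gamma> * y0 - 2 * (of_int n)\<^sup>2 * t0 - 2 * of_int n * y0)
      = - (A * (of_int n)\<^sup>2) + (- 2 * u * t0 / t - 2 * \<gamma> * t0 - 2 * y0) * of_int n + (- u\<^sup>2 / (2 * t) - 2 * \<gamma> * y0)"
      unfolding A_def y using t by (simp add: field_simps power2_eq_square)
    then show ?thesis by (simp only: sink_free_density[OF t] exp_add[symmetric])
  qed
  have "(\<lambda>n. sink t y (free_density t) (- n)) summable_on UNIV"
    unfolding snk by (intro summable_on_cmult_right summable_on_gaussian_int A)
  then show "sink t y (free_density t) summable_on UNIV"
    by (subst (asm) summable_on_reindex_bij_betw) (rule bij_uminus)
qed

lemma killed_density_image_sum:
  assumes t: "0 < t" and y: "0 < y" "y < t0 + t"
  shows "image_term \<gamma> t0 y0 t y summable_on UNIV"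
    and "free_density t y - exit_density t y = 1 / sqrt (2 * pi * t) * (\<Sum>\<^sub>\<infinity>n. image_term \<gamma> t0 y0 t y n)"
proof -
  let ?p = "source t y (free_density t)" and ?q = "sink t y (free_density t)"
  define p where "p = infsum ?p UNIV"
  define q where "q = infsum ?q UNIV"
  have p: "(?p has_sum p) UNIV" and q: "(?q has_sum q) UNIV"
    using summable_free_density[OF t] by (auto simp: p_def q_def)
  \<comment> \<open>The only pole inside the section is \<open>y\<close> itself, the pole number \<open>0\<close>.\<close>
  have source_ed: "source t y (exit_density t) n
      = ?p n + (if n = 0 then exit_density t y - free_density t y else 0)" for n
    using exit_density_outside[OF t poles_outside(1)[OF y refl, of n]]
    by (cases "n = 0") (auto simp: source_def)
  have sink_ed: "sink t y (exit_density t) n = ?q n" for n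
    using exit_density_outside[OF t poles_outside(2)[OF y refl, of n]] by (simp add: sink_def)
  have "((\<lambda>n::int. if n = 0 then exit_density t y - free_density t y else 0)
      has_sum (exit_density t y - free_density t y)) UNIV"
    by (rule has_sum_finite_neutralI[of "{0}"]) auto
  from has_sum_add[OF p this]
  have "(source t y (exit_density t) has_sum (p + (exit_density t y - free_density t y))) UNIV"
    by (simp only: source_ed[symmetric])
  note src = this
  have src_nonneg: "0 \<le> source t y (exit_density t) n" and snk_nonneg: "0 \<le> ?q n" for n
    unfolding source_def sink_def weight_def free_density_def
    by (intro mult_nonneg_nonneg exp_ge_zero exit_density_nonneg normal_density_nonneg)+
  have 1: "(\<integral>\<^sup>+n. ennreal (source t y (exit_density t) n) \<partial>count_space UNIV)
      = ennreal (p + (exit_density t y - free_density t y))"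
    by (rule nn_integral_count_space_has_sum[OF src src_nonneg])
  have 2: "(\<integral>\<^sup>+n. ennreal (sink t y (exit_density t) n) \<partial>count_space UNIV) = ennreal q"
    unfolding sink_ed by (rule nn_integral_count_space_has_sum[OF q snk_nonneg])
  have nn: "0 \<le> p + (exit_density t y - free_density t y)" and nn': "0 \<le> q"
    using has_sum_nonneg[OF src src_nonneg] has_sum_nonneg[OF q snk_nonneg] by blast+
  have pq: "free_density t y - exit_density t y = p - q"
  proof -
    have "ennreal (p + (exit_density t y - free_density t y)) = ennreal q"
      using source_eq_sink_exit_density[OF t y] unfolding 1 2 .
    then have "p + (exit_density t y - free_density t y) = q"
      using nn nn' by (simp only: ennreal_inj)
    then show ?thesis by simp
  qed
  have "((\<lambda>n. ?q (- n)) has_sum q) UNIV"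
    by (subst has_sum_reindex_bij_betw[OF bij_uminus]) (rule q)
  then have "((\<lambda>n. - ?q (- n)) has_sum (- q)) UNIV"
    by (simp add: has_sum_uminus)
  from has_sum_add[OF p this] have "((\<lambda>n. ?p n - ?q (- n)) has_sum (p - q)) UNIV"
    by simp
  then have "((\<lambda>n. 1 / sqrt (2 * pi * t) * image_term \<gamma> t0 y0 t y n) has_sum (p - q)) UNIV"
    by (simp only: image_term_eq[OF t])
  moreover define c where "c = sqrt (2 * pi * t)"
  ultimately have sum: "((\<lambda>n. 1 / c * image_term \<gamma> t0 y0 t y n) has_sum (p - q)) UNIV"
    by simp
  have c: "c \<noteq> 0" using t by (simp add: c_def)
  have I: "(image_term \<gamma> t0 y0 t y has_sum (c * (p - q))) UNIV"
    using has_sum_cmult_right[OF sum, of c] c by simp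
  then show "image_term \<gamma> t0 y0 t y summable_on UNIV" by (rule has_sum_imp_summable)
  show "free_density t y - exit_density t y = 1 / sqrt (2 * pi * t) * (\<Sum>\<^sub>\<infinity>n. image_term \<gamma> t0 y0 t y n)"
    unfolding pq infsumI[OF I] c_def[symmetric] using c by simp
qed

lemma killed_transition_density_exists:
  "killed_transition_density M W \<gamma> t0 y0 (\<lambda>t y. free_density t y - exit_density t y)"
  unfolding killed_transition_density_def
  by (auto simp: prob_not_exited integrable_free_density integrable_exit_density)

lemma continuous_killed_density:
  "0 < t \<Longrightarrow> continuous_on {0<..<t0 + t} (\<lambda>y. free_density t y - exit_density t y)"
  unfolding free_density_def
  by (intro continuous_intros continuous_on_normal_density continuous_on_subset[OF continuous_on_exit_density]) auto

lemma killed_transition_density_unique: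
  assumes p: "killed_transition_density M W \<gamma> t0 y0 p" and t: "0 < t"
    and cont: "continuous_on {0<..<t0 + t} (p t)" and y: "y \<in> {0<..<t0 + t}"
  shows "p t y = free_density t y - exit_density t y"
proof (rule continuous_density_unique[OF _ _ _ cont continuous_killed_density[OF t] _ y])
  show "integrable lborel (p t)" using p t by (simp add: killed_transition_density_def)
  show "integrable lborel (\<lambda>y. free_density t y - exit_density t y)"
    by (intro Bochner_Integration.integrable_diff integrable_free_density integrable_exit_density t)
  fix A :: "real set" assume "A \<in> sets borel"
  then show "(LINT y:A|lborel. p t y) = (LINT y:A|lborel. free_density t y - exit_density t y)"
    using p t prob_not_exited[OF t] by (simp add: killed_transition_density_def)
qed simp

end

theorem corollary20:
  fixes M :: "'a measure" and W :: "real \<Rightarrow> 'a \<Rightarrow> real" and \<gamma> t0 y0 :: real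
  assumes "standard_brownian_motion M W"
    and "0 < \<gamma>" and "\<gamma> < 1" and "0 < y0" and "y0 < t0"
  shows "(\<exists>p. killed_transition_density M W \<gamma> t0 y0 p \<and>
              (\<forall>t>0. continuous_on {0<..<t0 + t} (p t))) \<and>
    (\<forall>p. killed_transition_density M W \<gamma> t0 y0 p \<longrightarrow>
         (\<forall>t>0. continuous_on {0<..<t0 + t} (p t)) \<longrightarrow>
      (\<forall>t y. 0 < t \<longrightarrow> (t0 + t, y) \<in> space_time_cone \<longrightarrow>
        integrable M (exit_kernel W \<gamma> t0 y0 t y) \<and>
        image_term \<gamma> t0 y0 t y summable_on UNIV \<and>
        p t y = 1 / sqrt (2 * pi * t) * exp (- ((y - y0 - \<gamma> * t)\<^sup>2) / (2 * t))
                - integral\<^sup>L M (exit_kernel W \<gamma> t0 y0 t y) \<and>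
        p t y = 1 / sqrt (2 * pi * t) * (\<Sum>\<^sub>\<infinity>n. image_term \<gamma> t0 y0 t y n)))"
proof -
  interpret cone_exit M W \<gamma> t0 y0
    using assms by (intro cone_exit.intro cone_exit_axioms.intro)
  show ?thesis
  proof (intro conjI allI impI)
    show "\<exists>p. killed_transition_density M W \<gamma> t0 y0 p \<and> (\<forall>t>0. continuous_on {0<..<t0 + t} (p t))"
      using killed_transition_density_exists continuous_killed_density by blast
    fix p t y
    assume p: "killed_transition_density M W \<gamma> t0 y0 p" "\<forall>t>0. continuous_on {0<..<t0 + t} (p t)"
      and t: "(0::real) < t" and "(t0 + t, y) \<in> space_time_cone"
    then have y: "0 < y" "y < t0 + t" by (auto simp: space_time_cone_def)
    have eq: "p t y = free_density t y - exit_density t y"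
      using p t y by (intro killed_transition_density_unique) auto
    show "integrable M (\<kappa> t y)"
      using y by (intro integrable_exit_kernel t) auto
    show "image_term \<gamma> t0 y0 t y summable_on UNIV"
      by (rule killed_density_image_sum(1)[OF t y])
    show "p t y = 1 / sqrt (2 * pi * t) * exp (- ((y - y0 - \<gamma> * t)\<^sup>2) / (2 * t)) - integral\<^sup>L M (\<kappa> t y)"
      using t by (simp add: eq free_density_def exit_density_def normal_density_def diff_diff_eq)
    show "p t y = 1 / sqrt (2 * pi * t) * (\<Sum>\<^sub>\<infinity>n. image_term \<gamma> t0 y0 t y n)"
      unfolding eq by (rule killed_density_image_sum(2)[OF t y])
  qed
qed

end
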